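(* Let $(\Sigma,T)$ be a closed triangulated surface with vertex set $V=\{1,\dots,|V|\}$, edge set $E$ and triangle set $F$, and let $I\in\mathbb{R}^{|E|}$ be a weight with $I_{ij}\in[0,\infty)$ for every edge $ij\in E$. (Euclidean case) Let $\mathcal{R}_E\subset\mathbb{R}^{|V|}_{>0}$ be the open set of Euclidean-admissible radius vectors, and let $a:\mathcal{R}_E\to\mathbb{R}^{|V|}$ be the Euclidean cone-angle map. Then $a(cr)=a(r)$ for all $c>0$. Moreover, the restriction of $a$ to the normalized set $\{r\in\mathcal{R}_E:\prod_{i} r_i=1\}$ is a local diffeomorphism into the hyperplane $\{x\in\mathbb{R}^{|V|}:\sum_i x_i=\pi|F|\}$. Consequently, every $r\in\mathcal{R}_E$ has a neighborhood $U$ such that any $r'\in U$ with $a(r')=a(r)$ is a positive scalar multiple of $r$. That is, a Euclidean inversive distance circle packing is locally determined by its cone angles up to similarity. (Hyperbolic case) Let $\mathcal{R}_H\subset\mathbb{R}^{|V|}_{>0}$ be the open set of hyperbolic-admissible radius vectors, and let $a:\mathcal{R}_H\to\mathbb{R}^{|V|}$ be the hyperbolic cone-angle map. Then $a$ is a local diffeomorphism. In particular, it is locally injective, so a hyperbolic inversive distance circle packing is locally determined by its cone angles.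
   Context: Edge lengths. Given a radius vector $r=(r_1,\dots,r_{|V|})\in\mathbb{R}^{|V|}_{>0}$, assign to each edge $ij\in E$ a length $l_{ij}$. In Euclidean geometry, $$l_{ij}=\sqrt{r_i^2+r_j^2+2r_ir_jI_{ij}}.$$ In hyperbolic geometry, $l_{ij}>0$ is defined by $$\cosh l_{ij}=\cosh r_i\cosh r_j+I_{ij}\sinh r_i\sinh r_j.$$ These are the distances between the centers of two circles of radii $r_i,r_j$ whose inversive distance is $I_{ij}$. Admissible radius vectors. A radius vector $r$ is Euclidean-admissible (respectively hyperbolic-admissible) if, for every triangle $\triangle ijk\in F$, the three numbers $l_{ij},l_{jk},l_{ki}$ satisfy the strict triangle inequalities. Cone angles. For an admissible $r$, realize each triangle $\triangle ijk\in F$ as a Euclidean (respectively hyperbolic) triangle with side lengths $l_{ij},l_{jk},l_{ki}$. The cone angle $a_i(r)$ at a vertex $i$ is the sum of the inner angles at $i$ of all triangles of $F$ that contain $i$. *)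

theory Defs
  imports "HOL-Analysis.Analysis"
begin

section \<open>Closed triangulated surfaces (simplicial)\<close>

text \<open>Vertices form a finite type 'v (so V = UNIV); triangles are 3-element vertex sets,
  edges are 2-element vertex sets contained in some triangle.\<close>

definition tri_edges :: "'v set set \<Rightarrow> 'v set set" where
  "tri_edges F = {e. card e = 2 \<and> (\<exists>t\<in>F. e \<subseteq> t)}"

definition closed_tri_surface :: "'v::finite set set \<Rightarrow> bool" where
  "closed_tri_surface F \<longleftrightarrow>
     F \<noteq> {} \<and>
     (\<forall>t\<in>F. card t = 3) \<and>
     (\<forall>v. \<exists>t\<in>F. v \<in> t) \<and>
     (\<forall>e\<in>tri_edges F. card {t\<in>F. e \<subseteq> t} = 2) \<and>
     (\<forall>v. \<forall>w x. {v, w} \<in> tri_edges F \<longrightarrow> {v, x} \<in> tri_edges F \<longrightarrow>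
          (w, x) \<in> {(a, b). {v, a, b} \<in> F}\<^sup>*) \<and>
     (\<forall>v w. (v, w) \<in> {(a, b). {a, b} \<in> tri_edges F}\<^sup>*)"

section \<open>Edge lengths\<close>

definition eucl_len :: "('v set \<Rightarrow> real) \<Rightarrow> real^'v \<Rightarrow> 'v \<Rightarrow> 'v \<Rightarrow> real" where
  "eucl_len I r i j = sqrt ((r$i)\<^sup>2 + (r$j)\<^sup>2 + 2 * r$i * r$j * I {i, j})"

definition hyp_len :: "('v set \<Rightarrow> real) \<Rightarrow> real^'v \<Rightarrow> 'v \<Rightarrow> 'v \<Rightarrow> real" where
  "hyp_len I r i j = arcosh (cosh (r$i) * cosh (r$j) + I {i, j} * sinh (r$i) * sinh (r$j))"

text \<open>Strict triangle inequalities in every triangle (all labellings of its vertices).\<close>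
definition tri_ineqs :: "('v \<Rightarrow> 'v \<Rightarrow> real) \<Rightarrow> 'v set set \<Rightarrow> bool" where
  "tri_ineqs l F \<longleftrightarrow> (\<forall>t\<in>F. \<forall>i j k. t = {i, j, k} \<longrightarrow> l i j < l i k + l k j)"

definition eucl_admissible :: "('v set \<Rightarrow> real) \<Rightarrow> 'v set set \<Rightarrow> (real^'v) set" where
  "eucl_admissible I F = {r. (\<forall>i. 0 < r$i) \<and> tri_ineqs (eucl_len I r) F}"

definition hyp_admissible :: "('v set \<Rightarrow> real) \<Rightarrow> 'v set set \<Rightarrow> (real^'v) set" where
  "hyp_admissible I F = {r. (\<forall>i. 0 < r$i) \<and> tri_ineqs (hyp_len I r) F}"

section \<open>Inner angles and cone angles\<close>

text \<open>Inner angle at vertex i of the triangle with vertices i, j, k (law of cosines).\<close>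
definition eucl_angle :: "('v \<Rightarrow> 'v \<Rightarrow> real) \<Rightarrow> 'v \<Rightarrow> 'v \<Rightarrow> 'v \<Rightarrow> real" where
  "eucl_angle l i j k =
     arccos (((l i j)\<^sup>2 + (l i k)\<^sup>2 - (l j k)\<^sup>2) / (2 * l i j * l i k))"

definition hyp_angle :: "('v \<Rightarrow> 'v \<Rightarrow> real) \<Rightarrow> 'v \<Rightarrow> 'v \<Rightarrow> 'v \<Rightarrow> real" where
  "hyp_angle l i j k =
     arccos ((cosh (l i j) * cosh (l i k) - cosh (l j k)) / (sinh (l i j) * sinh (l i k)))"

text \<open>Angle at i in triangle t (i \<in> t): the angle formula is symmetric in the two other
  vertices, so we average over both orderings of them.\<close>
definition angle_in :: "('v \<Rightarrow> 'v \<Rightarrow> 'v \<Rightarrow> real) \<Rightarrow> 'v set \<Rightarrow> 'v \<Rightarrow> real" where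
  "angle_in ang t i =
     (\<Sum>p\<in>{(j, k). j \<in> t \<and> k \<in> t \<and> j \<noteq> i \<and> k \<noteq> i \<and> j \<noteq> k}. ang i (fst p) (snd p)) / 2"

definition cone_angles :: "('v \<Rightarrow> 'v \<Rightarrow> 'v \<Rightarrow> real) \<Rightarrow> 'v set set \<Rightarrow> real^'v" where
  "cone_angles ang F = (\<chi> i. \<Sum>t\<in>{t\<in>F. i \<in> t}. angle_in ang t i)"

definition eucl_cone_angle :: "('v set \<Rightarrow> real) \<Rightarrow> 'v set set \<Rightarrow> real^'v \<Rightarrow> real^'v" where
  "eucl_cone_angle I F r = cone_angles (eucl_angle (eucl_len I r)) F"

definition hyp_cone_angle :: "('v set \<Rightarrow> real) \<Rightarrow> 'v set set \<Rightarrow> real^'v \<Rightarrow> real^'v" where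
  "hyp_cone_angle I F r = cone_angles (hyp_angle (hyp_len I r)) F"

section \<open>Smooth maps and local diffeomorphisms between subsets of Euclidean space\<close>

text \<open>C-infinity on an open set S: there is a family of all iterated (Frechet) derivatives.
  D k vs x is the k-th derivative at x applied to the directions vs (length k).\<close>
definition smooth_on :: "('a::real_normed_vector \<Rightarrow> 'b::real_normed_vector) \<Rightarrow> 'a set \<Rightarrow> bool" where
  "smooth_on f S \<longleftrightarrow> open S \<and>
     (\<exists>D :: nat \<Rightarrow> 'a list \<Rightarrow> 'a \<Rightarrow> 'b.
        (\<forall>x\<in>S. D 0 [] x = f x) \<and>
        (\<forall>k vs x. length vs = k \<longrightarrow> x \<in> S \<longrightarrow>
           (D k vs has_derivative (\<lambda>h. D (Suc k) (h # vs) x)) (at x)))"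

text \<open>A map on an arbitrary subset A is smooth if it locally extends to a smooth map
  on an open set (as in Milnor).\<close>
definition smooth_map_on :: "('a::real_normed_vector \<Rightarrow> 'b::real_normed_vector) \<Rightarrow> 'a set \<Rightarrow> bool" where
  "smooth_map_on f A \<longleftrightarrow>
     (\<forall>x\<in>A. \<exists>U g. open U \<and> x \<in> U \<and> smooth_on g U \<and> (\<forall>y\<in>A \<inter> U. g y = f y))"

text \<open>f restricted to A is a local diffeomorphism into B.\<close>
definition local_diffeo :: "('a::real_normed_vector \<Rightarrow> 'b::real_normed_vector) \<Rightarrow> 'a set \<Rightarrow> 'b set \<Rightarrow> bool" where
  "local_diffeo f A B \<longleftrightarrow> f ` A \<subseteq> B \<and>
     (\<forall>x\<in>A. \<exists>U W g. open U \<and> x \<in> U \<and> open W \<and> f x \<in> W \<and>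
        f ` (U \<inter> A) = W \<inter> B \<and> g ` (W \<inter> B) = U \<inter> A \<and>
        (\<forall>y\<in>U \<inter> A. g (f y) = y) \<and> (\<forall>z\<in>W \<inter> B. f (g z) = z) \<and>
        smooth_map_on f (U \<inter> A) \<and> smooth_map_on g (W \<inter> B))"

end

theory Submission
  imports Defs
begin

text \<open>In logarithmic radius coordinates \<open>u\<close>, where \<open>dr\<^sub>i = r\<^sub>i du\<^sub>i\<close> (Euclidean) or
  \<open>dr\<^sub>i = sinh r\<^sub>i du\<^sub>i\<close> (hyperbolic), the derivative of the three angles of one triangle is a symmetric
  form. It is negative definite in the hyperbolic case, and negative semidefinite with kernel spanned by
  \<open>(1, 1, 1)\<close> in the Euclidean case. Summing over all triangles, the derivative of the cone angle map is
  injective, modulo scaling in the Euclidean case, and the smooth inverse function theorem applies.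

  For fixed side lengths the form of a triangle depends affinely on the \<open>r\<^sub>i\<^sup>2\<close> (respectively linearly on
  the \<open>cosh r\<^sub>i\<close>), and since the inversive distances are nonnegative it is as nondegenerate as claimed.
  In the hyperbolic case one deforms to the packing of three mutually tangent circles, where the sign is
  evident, without ever losing nondegeneracy; in the Euclidean case it suffices that the form, evaluated
  on the coordinates of the edge vectors of the triangle, gives a multiple of its area.\<close>

section \<open>Smooth maps and the inverse function theorem\<close>

text \<open>The coefficients of the form, one per edge, need not be positive: for a Euclidean
  triangle with all sides 1, squared radii 1/100 and 1/100 at two vertices and 9/10 at the third,
  all inversive distances are positive, but the weight of the edge between the two small circles is
  negative. So definiteness cannot be read off term by term; it is obtained from nondegeneracy
  together with one sign. In the hyperbolic case nondegeneracy comes from composing two injective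
  linear maps. From lengths to angles, injectivity is the infinitesimal fact that angles determine a
  hyperbolic triangle. From radii to lengths, each length increases strictly with both of its radii,
  so a variation fixing all three lengths would have to alternate in sign around a 3-cycle. The
  deformation keeps the side lengths and moves only the \<open>cosh\<close> of the radii along a
  segment: strict monotonicity is then a linear inequality that persists along the segment, while
  the condition that the triangle exists does not change. In the Euclidean case the determinant of
  the form modulo scaling factors explicitly and takes the role of nondegeneracy.\<close>

text \<open>Continuity of the last derivative is not required, so this is weaker than being \<open>C\<^sup>k\<close>; for all \<open>k\<close>
  together it amounts to smoothness.\<close>
primrec k_diff_on :: "nat \<Rightarrow> ('a::real_normed_vector \<Rightarrow> 'b::real_normed_vector) \<Rightarrow> 'a set \<Rightarrow> bool" where
  "k_diff_on 0 f S \<longleftrightarrow> True"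
| "k_diff_on (Suc k) f S \<longleftrightarrow>
     (\<exists>f'. (\<forall>x\<in>S. (f has_derivative f' x) (at x)) \<and> (\<forall>h. k_diff_on k (\<lambda>x. f' x h) S))"

lemma k_diff_on_cong:
  assumes "k_diff_on k f S" "open S" "\<And>x. x \<in> S \<Longrightarrow> f x = g x"
  shows "k_diff_on k g S"
proof (cases k)
  case (Suc n)
  then obtain f' where f': "\<forall>x\<in>S. (f has_derivative f' x) (at x)" "\<forall>h. k_diff_on n (\<lambda>x. f' x h) S"
    using assms(1) by auto
  have "(g has_derivative f' x) (at x)" if "x \<in> S" for x
    using has_derivative_transform_within_open[of f "f' x" x UNIV S g] f'(1) that assms(2,3) by auto
  then show ?thesis using Suc f'(2) by auto
qed simp

lemma k_diff_on_Suc: "k_diff_on (Suc k) f S \<Longrightarrow> k_diff_on k f S"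
proof (induction k arbitrary: f)
  case (Suc k)
  obtain f' where f': "\<forall>x\<in>S. (f has_derivative f' x) (at x)" "\<forall>h. k_diff_on (Suc k) (\<lambda>x. f' x h) S"
    using Suc.prems by (auto simp del: k_diff_on.simps(2) simp: k_diff_on.simps(2)[of "Suc k"])
  then have "\<forall>h. k_diff_on k (\<lambda>x. f' x h) S"
    using Suc.IH by blast
  with f'(1) show ?case by auto
qed simp

text \<open>The recursive notion is the one that is stable under inductive proofs of sum, product
  and chain rules. For the converse direction the family of derivatives is built by recursion on the
  list of directions, the head being the direction differentiated last; uniqueness of derivatives
  identifies it with whatever witnesses \<open>k_diff_on\<close> provides.\<close>

lemma smooth_on_iff_k_diff_on:
  "smooth_on f S \<longleftrightarrow> open S \<and> (\<forall>k. k_diff_on k f S)"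
proof
  assume "smooth_on f S"
  then obtain D where "open S" and D0: "\<forall>x\<in>S. D 0 [] x = f x"
    and D: "\<And>k vs x. length vs = k \<Longrightarrow> x \<in> S \<Longrightarrow> (D k vs has_derivative (\<lambda>h. D (Suc k) (h # vs) x)) (at x)"
    unfolding smooth_on_def by auto
  have "length vs = n \<Longrightarrow> k_diff_on k (D n vs) S" for k n vs
  proof (induction k arbitrary: n vs)
    case (Suc k)
    then have "k_diff_on k (D (Suc n) (h # vs)) S" for h
      using Suc.IH[of "h # vs" "Suc n"] by simp
    then show ?case
      using D Suc.prems by (auto intro!: exI[of _ "\<lambda>x h. D (Suc n) (h # vs) x"])
  qed simp
  then have "k_diff_on k (D 0 []) S" for k
    by simp
  then show "open S \<and> (\<forall>k. k_diff_on k f S)"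
    using k_diff_on_cong \<open>open S\<close> D0 by metis
next
  assume S: "open S \<and> (\<forall>k. k_diff_on k f S)"
  define D where "D = rec_list f (\<lambda>h vs g x. frechet_derivative g (at x) h)"
  have D_Cons: "D (h # vs) = (\<lambda>x. frechet_derivative (D vs) (at x) h)" for h vs
    by (simp add: D_def)
  have kD: "\<forall>k. k_diff_on k (D vs) S" for vs
  proof (induction vs)
    case Nil
    then show ?case using S by (simp add: D_def)
  next
    case (Cons h vs)
    show ?case
    proof
      fix k
      obtain f' where f': "\<forall>x\<in>S. (D vs has_derivative f' x) (at x)" "\<forall>h. k_diff_on k (\<lambda>x. f' x h) S"
        using Cons[rule_format, of "Suc k"] by auto
      show "k_diff_on k (D (h # vs)) S"
        unfolding D_Cons
        by (rule k_diff_on_cong[of _ "\<lambda>x. f' x h"]) (use f' S in \<open>auto simp: frechet_derivative_at[symmetric]\<close>)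
    qed
  qed
  have "(D vs has_derivative (\<lambda>h. D (h # vs) x)) (at x)" if "x \<in> S" for vs x
  proof -
    have "D vs differentiable at x"
      using kD[of vs, rule_format, of 1] that by (auto simp: differentiable_def)
    then show ?thesis
      unfolding D_Cons by (simp add: frechet_derivative_works)
  qed
  then show "smooth_on f S"
    unfolding smooth_on_def using S by (auto intro!: exI[of _ "\<lambda>k. D"] simp: D_def)
qed

section \<open>Closure of differentiability under algebra, composition and elementary
  functions\<close>

lemma k_diff_on_const [simp]: "k_diff_on k (\<lambda>x. c) S"
proof (induction k arbitrary: c)
  case (Suc k)
  then show ?case by (auto intro!: exI[of _ "\<lambda>x h. 0"])
qed simp

lemma k_diff_on_bounded_linear:
  assumes "bounded_linear L"
  shows "k_diff_on k f S \<Longrightarrow> k_diff_on k (\<lambda>x. L (f x)) S"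
proof (induction k arbitrary: f)
  case (Suc k)
  then obtain f' where f': "\<forall>x\<in>S. (f has_derivative f' x) (at x)" "\<forall>h. k_diff_on k (\<lambda>x. f' x h) S"
    by auto
  with Suc.IH show ?case
    by (auto intro!: exI[of _ "\<lambda>x h. L (f' x h)"] bounded_linear.has_derivative[OF assms])
qed simp

lemma k_diff_on_ident: "k_diff_on k (\<lambda>x. x) S"
proof (cases k)
  case (Suc n)
  then show ?thesis by (auto intro!: exI[of _ "\<lambda>x h. h"])
qed simp

lemma k_diff_on_add: "k_diff_on k f S \<Longrightarrow> k_diff_on k g S \<Longrightarrow> k_diff_on k (\<lambda>x. f x + g x) S"
proof (induction k arbitrary: f g)
  case (Suc k)
  then obtain f' g' where "\<forall>x\<in>S. (f has_derivative f' x) (at x)" "\<forall>h. k_diff_on k (\<lambda>x. f' x h) S"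
     "\<forall>x\<in>S. (g has_derivative g' x) (at x)" "\<forall>h. k_diff_on k (\<lambda>x. g' x h) S"
    by auto
  with Suc.IH show ?case
    by (auto intro!: exI[of _ "\<lambda>x h. f' x h + g' x h"] has_derivative_add)
qed simp

lemma k_diff_on_bilinear:
  assumes "bounded_bilinear b"
  shows "k_diff_on k f S \<Longrightarrow> k_diff_on k g S \<Longrightarrow> k_diff_on k (\<lambda>x. b (f x) (g x)) S"
proof (induction k arbitrary: f g)
  case (Suc k)
  then obtain f' g' where "\<forall>x\<in>S. (f has_derivative f' x) (at x)" "\<forall>h. k_diff_on k (\<lambda>x. f' x h) S"
     "\<forall>x\<in>S. (g has_derivative g' x) (at x)" "\<forall>h. k_diff_on k (\<lambda>x. g' x h) S"
    by auto
  moreover have "k_diff_on k f S" "k_diff_on k g S"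
    using Suc.prems k_diff_on_Suc by blast+
  ultimately show ?case
    using Suc.IH
    by (auto intro!: exI[of _ "\<lambda>x h. b (f x) (g' x h) + b (f' x h) (g x)"] k_diff_on_add
          bounded_bilinear.FDERIV[OF assms])
qed simp

lemmas k_diff_on_scaleR = k_diff_on_bilinear[OF bounded_bilinear_scaleR]
lemmas k_diff_on_mult = k_diff_on_bilinear[OF bounded_bilinear_mult]
lemmas k_diff_on_inner_left = k_diff_on_bounded_linear[OF bounded_linear_inner_left]
lemmas k_diff_on_minus = k_diff_on_bounded_linear[OF bounded_linear_minus[OF bounded_linear_ident]]
lemmas k_diff_on_nth = k_diff_on_bounded_linear[OF bounded_linear_vec_nth]

lemma k_diff_on_diff: "k_diff_on k f S \<Longrightarrow> k_diff_on k g S \<Longrightarrow> k_diff_on k (\<lambda>x. f x - g x) S"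
  using k_diff_on_add[OF _ k_diff_on_minus] by fastforce

lemma k_diff_on_sum:
  "(\<And>i. i \<in> A \<Longrightarrow> k_diff_on k (f i) S) \<Longrightarrow> k_diff_on k (\<lambda>x. \<Sum>i\<in>A. f i x) S"
  by (induction A rule: infinite_finite_induct) (auto intro: k_diff_on_add)

lemma k_diff_on_prod:
  fixes f :: "'i \<Rightarrow> 'a::real_normed_vector \<Rightarrow> real"
  shows "(\<And>i. i \<in> A \<Longrightarrow> k_diff_on k (f i) S) \<Longrightarrow> k_diff_on k (\<lambda>x. \<Prod>i\<in>A. f i x) S"
  by (induction A rule: infinite_finite_induct) (auto intro: k_diff_on_mult)

lemma k_diff_on_power:
  fixes f :: "'a::real_normed_vector \<Rightarrow> real"
  shows "k_diff_on k f S \<Longrightarrow> k_diff_on k (\<lambda>x. f x ^ n) S"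
  by (induction n) (auto intro: k_diff_on_mult)

lemma k_diff_on_vec:
  fixes f :: "'a::real_normed_vector \<Rightarrow> real^'n"
  assumes "\<And>i. k_diff_on k (\<lambda>x. f x $ i) S"
  shows "k_diff_on k f S"
proof -
  have "f = (\<lambda>x. \<Sum>i\<in>UNIV. (f x $ i) *\<^sub>R axis i 1)"
    by (auto simp: vec_eq_iff axis_def if_distrib cong: if_cong)
  moreover have "k_diff_on k (\<lambda>x. \<Sum>i\<in>UNIV. (f x $ i) *\<^sub>R axis i (1::real) :: real^'n) S"
    by (intro k_diff_on_sum k_diff_on_scaleR assms) simp
  ultimately show ?thesis by simp
qed

lemma k_diff_on_compose:
  fixes f :: "'b::euclidean_space \<Rightarrow> 'c::real_normed_vector"
  assumes "open S"
  shows "k_diff_on k f T \<Longrightarrow> k_diff_on k g S \<Longrightarrow> g ` S \<subseteq> T \<Longrightarrow> k_diff_on k (\<lambda>x. f (g x)) S"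
proof (induction k arbitrary: f)
  case (Suc k)
  then obtain f' g' where f': "\<forall>x\<in>T. (f has_derivative f' x) (at x)" "\<forall>h. k_diff_on k (\<lambda>x. f' x h) T"
     and g': "\<forall>x\<in>S. (g has_derivative g' x) (at x)" "\<forall>h. k_diff_on k (\<lambda>x. g' x h) S"
    by auto
  have gk: "k_diff_on k g S"
    using Suc.prems(2) k_diff_on_Suc by blast
  \<comment> \<open>The direction \<open>g' x h\<close> varies with \<open>x\<close>, while the
    induction hypothesis speaks of \<open>f'\<close> in a fixed direction only. Expanding the
    direction in \<open>Basis\<close> leaves fixed directions with differentiable
    coefficients.\<close>
  have "k_diff_on k (\<lambda>x. f' (g x) (g' x h)) S" for h
  proof (rule k_diff_on_cong)
    show "k_diff_on k (\<lambda>x. \<Sum>b\<in>Basis. (g' x h \<bullet> b) *\<^sub>R f' (g x) b) S"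
      using Suc.IH f'(2) gk Suc.prems(3) g'(2)
      by (intro k_diff_on_sum k_diff_on_scaleR k_diff_on_inner_left) auto
    fix x assume "x \<in> S"
    then have "(f has_derivative f' (g x)) (at (g x))"
      using f'(1) Suc.prems(3) by auto
    then have lin: "linear (f' (g x))"
      using has_derivative_linear by blast
    have "f' (g x) (g' x h) = f' (g x) (\<Sum>b\<in>Basis. (g' x h \<bullet> b) *\<^sub>R b)"
      by (simp add: euclidean_representation)
    also have "\<dots> = (\<Sum>b\<in>Basis. (g' x h \<bullet> b) *\<^sub>R f' (g x) b)"
      by (simp add: linear_sum[OF lin] linear_scale[OF lin])
    finally show "(\<Sum>b\<in>Basis. (g' x h \<bullet> b) *\<^sub>R f' (g x) b) = f' (g x) (g' x h)" by simp
  qed (rule assms)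
  moreover have "((\<lambda>x. f (g x)) has_derivative (\<lambda>h. f' (g x) (g' x h))) (at x)" if "x \<in> S" for x
    using has_derivative_compose[of g "g' x" x UNIV f "f' (g x)"] f' g' Suc.prems(3) that by auto
  ultimately show ?case
    by (auto intro!: exI[of _ "\<lambda>x h. f' (g x) (g' x h)"])
qed simp

lemma k_diff_on_inverse: "k_diff_on k (inverse :: real \<Rightarrow> real) (- {0})"
proof (induction k)
  case (Suc k)
  then show ?case
    by (auto intro!: exI[of _ "\<lambda>x h. - (inverse x * h * inverse x)"] has_derivative_inverse'
         k_diff_on_minus k_diff_on_mult)
qed simp

lemma k_diff_on_divide:
  fixes f g :: "'a::real_normed_vector \<Rightarrow> real"
  assumes "open S" "k_diff_on k f S" "k_diff_on k g S" "\<And>x. x \<in> S \<Longrightarrow> g x \<noteq> 0"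
  shows "k_diff_on k (\<lambda>x. f x / g x) S"
proof -
  have "k_diff_on k (\<lambda>x. f x * inverse (g x)) S"
    using assms by (intro k_diff_on_mult k_diff_on_compose[OF assms(1) k_diff_on_inverse]) auto
  then show ?thesis by (simp add: divide_inverse)
qed

lemma k_diff_on_Suc_real:
  fixes f :: "real \<Rightarrow> real"
  assumes "\<And>x. x \<in> S \<Longrightarrow> (f has_real_derivative f' x) (at x)" "k_diff_on k f' S"
  shows "k_diff_on (Suc k) f S"
  using assms
  by (auto simp: has_field_derivative_def intro!: exI[of _ "\<lambda>x h. f' x * h"] k_diff_on_mult)

lemma k_diff_on_sqrt: "k_diff_on k sqrt {0<..}"
proof (induction k)
  case (Suc k)
  have "k_diff_on k (\<lambda>x. inverse (sqrt x) / 2) {0<..}"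
    using Suc by (intro k_diff_on_divide k_diff_on_compose[OF _ k_diff_on_inverse]) auto
  then show ?case
    by (rule k_diff_on_Suc_real[rotated]) (simp add: DERIV_real_sqrt)
qed simp

lemma k_diff_on_sqrt_compose:
  "open S \<Longrightarrow> k_diff_on k f S \<Longrightarrow> (\<And>x. x \<in> S \<Longrightarrow> 0 < f x) \<Longrightarrow> k_diff_on k (\<lambda>x. sqrt (f x)) S"
  by (rule k_diff_on_compose[OF _ k_diff_on_sqrt]) auto

lemma k_diff_on_arccos: "k_diff_on k arccos {-1<..<1}"
proof (cases k)
  case (Suc n)
  have "k_diff_on n (\<lambda>x. inverse (- sqrt (1 - x\<^sup>2))) {-1<..<1}"
    by (intro k_diff_on_compose[OF _ k_diff_on_inverse] k_diff_on_minus
        k_diff_on_sqrt_compose k_diff_on_diff k_diff_on_power k_diff_on_ident k_diff_on_const)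
      (auto simp: abs_square_eq_1 abs_square_less_1)
  then show ?thesis
    unfolding Suc by (rule k_diff_on_Suc_real[rotated]) (use DERIV_arccos in auto)
qed simp

lemma k_diff_on_cosh_sinh: "k_diff_on k (cosh :: real \<Rightarrow> real) UNIV \<and> k_diff_on k (sinh :: real \<Rightarrow> real) UNIV"
proof (induction k)
  case (Suc k)
  then show ?case
    by (intro conjI k_diff_on_Suc_real[of _ cosh sinh] k_diff_on_Suc_real[of _ sinh cosh])
      (auto intro!: derivative_eq_intros)
qed simp

lemma k_diff_on_det:
  fixes A :: "'a::real_normed_vector \<Rightarrow> real^'n^'n"
  assumes "\<And>i j. k_diff_on k (\<lambda>x. A x $ i $ j) S"
  shows "k_diff_on k (\<lambda>x. det (A x)) S"
  unfolding det_def
  by (intro k_diff_on_sum k_diff_on_mult k_diff_on_prod assms k_diff_on_const)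

section \<open>Smooth inverse functions and local diffeomorphisms between subsets\<close>

lemma smooth_on_imp_smooth_map_on: "smooth_on f S \<Longrightarrow> A \<subseteq> S \<Longrightarrow> smooth_map_on f A"
  unfolding smooth_map_on_def
  by (intro ballI exI[of _ S] exI[of _ f]) (auto simp: smooth_on_def)

text \<open>The classical theorem gives a differentiable local inverse \<open>g\<close> whose
  derivative at \<open>y\<close> inverts that of \<open>f\<close> at \<open>g y\<close>. Smoothness
  is bootstrapped: if \<open>g\<close> is \<open>k\<close> times differentiable, so are the entries
  of the Jacobian of \<open>f\<close> along \<open>g\<close>, hence by Cramer's rule those of its
  inverse, and \<open>g\<close> gains one order.\<close>

lemma smooth_inverse_function:
  fixes f :: "real^'n \<Rightarrow> real^'n"
  assumes sm: "smooth_on f S" and x0: "x0 \<in> S"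
    and der: "(f has_derivative f0) (at x0)" and inj: "\<And>h. f0 h = 0 \<Longrightarrow> h = 0"
  obtains U V g where "open U" "U \<subseteq> S" "x0 \<in> U" "open V" "f ` U = V" "g ` V = U"
    "\<forall>y\<in>U. g (f y) = y" "\<forall>z\<in>V. f (g z) = z" "smooth_on g V"
proof -
  have "open S" and kf: "\<And>k. k_diff_on k f S"
    using sm by (auto simp: smooth_on_iff_k_diff_on)
  define f' where "f' = (\<lambda>x. frechet_derivative f (at x))"
  have f': "(f has_derivative f' x) (at x)" if "x \<in> S" for x
  proof -
    have "f differentiable at x"
      using kf[of 1] that by (auto simp: differentiable_def)
    then show ?thesis
      unfolding f'_def by (simp add: frechet_derivative_works)
  qed
  have kf': "k_diff_on k (\<lambda>x. f' x h) S" for k h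
  proof -
    obtain F where F: "\<forall>x\<in>S. (f has_derivative F x) (at x)" "\<forall>h. k_diff_on k (\<lambda>x. F x h) S"
      using kf[of "Suc k"] by auto
    show ?thesis
      by (rule k_diff_on_cong[of _ "\<lambda>x. F x h"])
        (use F \<open>open S\<close> in \<open>auto simp: f'_def frechet_derivative_at[symmetric]\<close>)
  qed
  define F where "F = (\<lambda>x. Blinfun (f' x))"
  have F: "blinfun_apply (F x) = f' x" if "x \<in> S" for x
    unfolding F_def using f'[OF that] has_derivative_bounded_linear bounded_linear_Blinfun_apply by blast
  \<comment> \<open>In finite dimension, continuity in each fixed direction already gives continuity
    in operator norm, which the inverse function theorem asks for.\<close>
  have "continuous_on S (\<lambda>x. F x h)" for h
  proof -
    obtain G where "\<forall>x\<in>S. ((\<lambda>x. f' x h) has_derivative G x) (at x)"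
      using kf'[of 1 h] by auto
    then have "continuous_on S (\<lambda>x. f' x h)"
      by (meson continuous_at_imp_continuous_on has_derivative_continuous)
    then show ?thesis
      by (rule continuous_on_cong[THEN iffD1, rotated 2]) (auto simp: F)
  qed
  then have contF: "continuous_on S F"
    by (intro continuous_on_blinfun_componentwise)
  have f0: "f' x0 = f0"
    using der f'[OF x0] has_derivative_unique by blast
  have lin0: "linear f0"
    using der has_derivative_linear by blast
  then have "inj f0"
    using inj linear_injective_0 by blast
  then obtain g0 where g0: "linear g0" "g0 \<circ> f0 = id"
    using linear_injective_left_inverse[OF lin0] by blast
  have invf: "Blinfun g0 o\<^sub>L F x0 = id_blinfun"
    using g0 F[OF x0] f0
    by (intro blinfun_eqI) (auto simp: bounded_linear_Blinfun_apply linear_conv_bounded_linear dest: fun_cong)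
  obtain U V g g' where U: "open U" "U \<subseteq> S" "x0 \<in> U" and V: "open V" "f x0 \<in> V"
    and hom: "homeomorphism U V f g"
    and g': "\<And>y. y \<in> V \<Longrightarrow> (g has_derivative (g' y)) (at y)"
    and g'_eq: "\<And>y. y \<in> V \<Longrightarrow> g' y = inv (blinfun_apply (F (g y)))"
    and bij: "\<And>y. y \<in> V \<Longrightarrow> bij (blinfun_apply (F (g y)))"
    using inverse_function_theorem[OF \<open>open S\<close> _ contF x0 invf] f' F by metis
  have gV: "g ` V = U" "f ` U = V" and gf: "\<And>y. y \<in> U \<Longrightarrow> g (f y) = y" and fg: "\<And>z. z \<in> V \<Longrightarrow> f (g z) = z"
    using hom by (auto simp: homeomorphism_def)
  have "k_diff_on k g V" for k
  proof (induction k)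
    case (Suc k)
    define J where "J = (\<lambda>y. matrix (f' (g y)))"
    have kJ: "k_diff_on k (\<lambda>y. J y $ i $ j) V" for i j
    proof -
      have "k_diff_on k (\<lambda>y. f' (g y) (axis j 1) $ i) V"
        using U(2) gV(1) by (intro k_diff_on_nth k_diff_on_compose[OF V(1) kf' Suc]) auto
      then show ?thesis by (simp add: J_def matrix_def)
    qed
    have "k_diff_on k (\<lambda>y. g' y h) V" for h
    proof -
      \<comment> \<open>The Cramer matrix: the Jacobian with column \<open>l\<close> replaced by
        \<open>h\<close>.\<close>
      define B where "B = (\<lambda>y l. (\<chi> i j. if j = l then h $ i else J y $ i $ j) :: real^'n^'n)"
      have eq: "det (J y) \<noteq> 0 \<and> g' y h = (\<chi> l. det (B y l) / det (J y))" if "y \<in> V" for y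
      proof -
        have yS: "g y \<in> S" using that gV(1) U(2) by auto
        have lin: "linear (f' (g y))"
          using f'[OF yS] has_derivative_linear by blast
        have bij': "bij (f' (g y))" using bij[OF that] F[OF yS] by simp
        have "f' (g y) (g' y h) = h"
          using g'_eq[OF that] F[OF yS] bij' by (simp add: bij_is_surj surj_f_inv_f)
        then have Jh: "J y *v g' y h = h"
          unfolding J_def using matrix_works lin by (simp add: linear_matrix_vector_mul_eq)
        have "invertible (J y)"
          unfolding J_def using lin bij'
          by (metis bij_is_inj inj_matrix_vector_mult invertible_left_inverse matrix_left_invertible_injective matrix_vector_mul)
        then have d: "det (J y) \<noteq> 0"
          using invertible_det_nz by blast
        with Jh show ?thesis
          unfolding B_def using cramer[OF d] by blast
      qed
      have "k_diff_on k (\<lambda>y. B y l $ i $ j) V" for l i j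
        by (cases "j = l") (auto simp: B_def kJ)
      then have "k_diff_on k (\<lambda>y. \<chi> l. det (B y l) / det (J y)) V"
        using eq by (intro k_diff_on_vec, simp, intro k_diff_on_divide V k_diff_on_det kJ) auto
      then show ?thesis
        by (rule k_diff_on_cong) (use eq V in auto)
    qed
    with g' show ?case by auto
  qed simp
  then have "smooth_on g V"
    using V by (simp add: smooth_on_iff_k_diff_on)
  then show ?thesis
    using that U V gV gf fg by blast
qed

text \<open>Avoids charts on \<open>A\<close> and \<open>B\<close>. The map \<open>\<Phi>\<close> is
  a diffeomorphism of open sets of the ambient space, agrees with \<open>f\<close> on
  \<open>A\<close>, and has \<open>A\<close> as its preimage of \<open>B\<close>, so its local
  inverse restricts to one of \<open>f\<close>. In the hyperbolic case \<open>\<Phi>\<close> is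
  \<open>f\<close> and \<open>B\<close> is everything; in the Euclidean case \<open>\<Phi>\<close>
  is a correction of \<open>f\<close> that makes the derivative injective.\<close>

lemma local_diffeo_inverse_function:
  fixes f \<Phi> :: "real^'n \<Rightarrow> real^'n"
  assumes f: "smooth_on f S" and \<Phi>: "smooth_on \<Phi> S"
    and A: "\<And>x. x \<in> A \<longleftrightarrow> x \<in> S \<and> \<Phi> x \<in> B" and eq: "\<And>x. x \<in> A \<Longrightarrow> \<Phi> x = f x"
    and inj: "\<And>x. x \<in> A \<Longrightarrow> \<exists>\<Phi>'. (\<Phi> has_derivative \<Phi>') (at x) \<and> (\<forall>h. \<Phi>' h = 0 \<longrightarrow> h = 0)"
  shows "local_diffeo f A B"
  unfolding local_diffeo_def
proof (intro conjI ballI)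
  show "f ` A \<subseteq> B"
    using A eq by force
  fix x assume "x \<in> A"
  then have "x \<in> S" using A by blast
  obtain \<Phi>' where \<Phi>': "(\<Phi> has_derivative \<Phi>') (at x)" "\<And>h. \<Phi>' h = 0 \<Longrightarrow> h = 0"
    using inj[OF \<open>x \<in> A\<close>] by blast
  obtain U V g where U: "open U" "U \<subseteq> S" "x \<in> U" and V: "open V" "\<Phi> ` U = V" "g ` V = U"
    and g: "\<forall>y\<in>U. g (\<Phi> y) = y" "\<forall>z\<in>V. \<Phi> (g z) = z" and sg: "smooth_on g V"
    using smooth_inverse_function[OF \<Phi> \<open>x \<in> S\<close> \<Phi>'] .
  have gA: "g z \<in> U \<inter> A" if "z \<in> V \<inter> B" for z
    using that V(3) g(2) A U(2) by auto
  have fA: "f y \<in> V \<inter> B" "f y = \<Phi> y" if "y \<in> U \<inter> A" for y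
    using that V(2) eq[of y, symmetric] A by auto
  have fg: "f (g z) = z" if "z \<in> V \<inter> B" for z
    using gA[OF that] eq[of "g z"] g(2) that by auto
  have gf: "g (f y) = y" if "y \<in> U \<inter> A" for y
    using fA(2)[OF that] g(1) that by auto
  have "f x \<in> V"
    using fA[of x] U \<open>x \<in> A\<close> by auto
  moreover have "f ` (U \<inter> A) = V \<inter> B"
  proof
    show "f ` (U \<inter> A) \<subseteq> V \<inter> B" using fA(1) by blast
    show "V \<inter> B \<subseteq> f ` (U \<inter> A)"
      by (rule subsetI, rule image_eqI[where x = "g _"]) (erule fg[symmetric], erule gA)
  qed
  moreover have "g ` (V \<inter> B) = U \<inter> A"
  proof
    show "g ` (V \<inter> B) \<subseteq> U \<inter> A" using gA by blast
    show "U \<inter> A \<subseteq> g ` (V \<inter> B)"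
      by (rule subsetI, rule image_eqI[where x = "f _"]) (erule gf[symmetric], erule fA(1))
  qed
  moreover have "smooth_map_on f (U \<inter> A)" "smooth_map_on g (V \<inter> B)"
    using smooth_on_imp_smooth_map_on f sg U(2) by blast+
  ultimately show "\<exists>U W g. open U \<and> x \<in> U \<and> open W \<and> f x \<in> W \<and> f ` (U \<inter> A) = W \<inter> B \<and> g ` (W \<inter> B) = U \<inter> A \<and>
      (\<forall>y\<in>U \<inter> A. g (f y) = y) \<and> (\<forall>z\<in>W \<inter> B. f (g z) = z) \<and> smooth_map_on f (U \<inter> A) \<and> smooth_map_on g (W \<inter> B)"
    using U V(1) gf fg by (intro exI[of _ U] exI[of _ V] exI[of _ g]) simp
qed

section \<open>Cone angles of a family of triangles\<close>

lemma angle_in_triple: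
  assumes "i \<noteq> j" "i \<noteq> k" "j \<noteq> k" "ang i k j = ang i j k"
  shows "angle_in ang {i, j, k} i = ang i j k"
proof -
  have "{(a, b). a \<in> {i, j, k} \<and> b \<in> {i, j, k} \<and> a \<noteq> i \<and> b \<noteq> i \<and> a \<noteq> b} = {(j, k), (k, j)}"
    using assms by auto
  then show ?thesis
    using assms by (simp add: angle_in_def)
qed

lemma card_3_member:
  assumes "card t = 3" "i \<in> t"
  obtains j k where "t = {i, j, k}" "i \<noteq> j" "i \<noteq> k" "j \<noteq> k"
proof -
  obtain x y z where t: "t = {x, y, z}" "x \<noteq> y" "y \<noteq> z" "x \<noteq> z"
    using assms(1) by (auto simp: card_3_iff)
  then consider "i = x" | "i = y" | "i = z"
    using assms(2) by blast
  then show ?thesis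
    using that[of y z] that[of x z] that[of x y] t by cases (auto simp: insert_commute)
qed

lemma smooth_on_cone_angles:
  fixes ang :: "real^'v::finite \<Rightarrow> 'v \<Rightarrow> 'v \<Rightarrow> 'v \<Rightarrow> real"
  assumes "open S" and card: "\<And>t. t \<in> F \<Longrightarrow> card t = 3"
    and sym: "\<And>r i j k. ang r i k j = ang r i j k"
    and smooth: "\<And>n i j k. {i, j, k} \<in> F \<Longrightarrow> i \<noteq> j \<Longrightarrow> i \<noteq> k \<Longrightarrow> j \<noteq> k \<Longrightarrow> k_diff_on n (\<lambda>r. ang r i j k) S"
  shows "smooth_on (\<lambda>r. cone_angles (ang r) F) S"
proof -
  have "k_diff_on n (\<lambda>r. angle_in (ang r) t i) S" if tF: "t \<in> F" "i \<in> t" for n t i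
  proof -
    obtain j k where t: "t = {i, j, k}" "i \<noteq> j" "i \<noteq> k" "j \<noteq> k"
      using card_3_member[OF card[OF tF(1)] tF(2)] .
    have "(\<lambda>r. angle_in (ang r) t i) = (\<lambda>r. ang r i j k)"
      unfolding t(1) by (intro ext) (rule angle_in_triple[where ang = "ang _", OF t(2-4) sym])
    then show ?thesis using smooth t tF by simp
  qed
  then have "k_diff_on n (\<lambda>r. cone_angles (ang r) F) S" for n
    unfolding cone_angles_def by (intro k_diff_on_vec) (auto intro!: k_diff_on_sum)
  then show ?thesis
    using assms(1) by (simp add: smooth_on_iff_k_diff_on)
qed

text \<open>In the applications \<open>\<xi> h\<close> is the variation \<open>h\<close> in
  logarithmic coordinates, and \<open>Z h t\<close> says that it is trivial on the triangle
  \<open>t\<close>. If \<open>T h = 0\<close>, pair it with \<open>\<xi> h\<close> and regroup the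
  sum over vertices by triangles: no summand is positive, so none may be negative.\<close>

lemma cone_angles_derivative_kernel:
  fixes ang :: "real^'v::finite \<Rightarrow> 'v \<Rightarrow> 'v \<Rightarrow> 'v \<Rightarrow> real" and \<xi> :: "real^'v \<Rightarrow> 'v \<Rightarrow> real"
  assumes card: "\<And>t. t \<in> F \<Longrightarrow> card t = 3"
    and sym: "\<And>r i j k. ang r i k j = ang r i j k"
    and tri: "\<And>i j k. {i, j, k} \<in> F \<Longrightarrow> i \<noteq> j \<Longrightarrow> i \<noteq> k \<Longrightarrow> j \<noteq> k \<Longrightarrow>
      \<exists>T1 T2 T3. ((\<lambda>r. ang r i j k) has_derivative T1) (at r) \<and>
        ((\<lambda>r. ang r j k i) has_derivative T2) (at r) \<and> ((\<lambda>r. ang r k i j) has_derivative T3) (at r) \<and>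
        (\<forall>h. \<not> Z h {i, j, k} \<longrightarrow> \<xi> h i * T1 h + \<xi> h j * T2 h + \<xi> h k * T3 h < 0) \<and>
        (\<forall>h. \<xi> h i * T1 h + \<xi> h j * T2 h + \<xi> h k * T3 h \<le> 0)"
  obtains T where "((\<lambda>r. cone_angles (ang r) F) has_derivative T) (at r)"
    "\<And>h t. T h = 0 \<Longrightarrow> t \<in> F \<Longrightarrow> Z h t"
proof -
  define P where "P = (\<lambda>t \<tau>. (\<forall>i\<in>t. ((\<lambda>r. angle_in (ang r) t i) has_derivative \<tau> i) (at r)) \<and>
      (\<forall>h. \<not> Z h t \<longrightarrow> (\<Sum>i\<in>t. \<xi> h i * \<tau> i h) < 0) \<and> (\<forall>h. (\<Sum>i\<in>t. \<xi> h i * \<tau> i h) \<le> 0))"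
  have "\<exists>\<tau>. (\<forall>i\<in>t. ((\<lambda>r. angle_in (ang r) t i) has_derivative \<tau> i) (at r)) \<and>
      (\<forall>h. \<not> Z h t \<longrightarrow> (\<Sum>i\<in>t. \<xi> h i * \<tau> i h) < 0) \<and> (\<forall>h. (\<Sum>i\<in>t. \<xi> h i * \<tau> i h) \<le> 0)" if tF: "t \<in> F" for t
  proof -
    obtain i j k where t: "t = {i, j, k}" "i \<noteq> j" "i \<noteq> k" "j \<noteq> k"
      using card[OF tF] by (auto simp: card_3_iff)
    obtain T1 T2 T3 where T: "((\<lambda>r. ang r i j k) has_derivative T1) (at r)"
        "((\<lambda>r. ang r j k i) has_derivative T2) (at r)" "((\<lambda>r. ang r k i j) has_derivative T3) (at r)"
        "\<forall>h. \<not> Z h {i, j, k} \<longrightarrow> \<xi> h i * T1 h + \<xi> h j * T2 h + \<xi> h k * T3 h < 0"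
        "\<forall>h. \<xi> h i * T1 h + \<xi> h j * T2 h + \<xi> h k * T3 h \<le> 0"
      using tri[of i j k] tF t by auto
    have t': "t = {j, k, i}" "t = {k, i, j}"
      unfolding t(1) by blast+
    have ang1: "angle_in (ang r) t i = ang r i j k" for r
      unfolding t(1) by (rule angle_in_triple[where ang = "ang _", OF t(2-4) sym])
    have ang2: "angle_in (ang r) t j = ang r j k i" for r
      unfolding t'(1) by (rule angle_in_triple[where ang = "ang _", OF t(4) t(2,3)[symmetric] sym])
    have ang3: "angle_in (ang r) t k = ang r k i j" for r
      unfolding t'(2) by (rule angle_in_triple[where ang = "ang _", OF t(3,4)[symmetric] t(2) sym])
    have sum: "(\<Sum>a\<in>t. f a) = f i + f j + f k" for f :: "'v \<Rightarrow> real"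
      using t by (simp add: add.assoc)
    show ?thesis
      unfolding sum using t T
      by (intro exI[of _ "\<lambda>a. if a = i then T1 else if a = j then T2 else T3"]) (auto simp: ang1[unfolded t(1)] ang2[unfolded t(1)] ang3[unfolded t(1)])
  qed
  then have "\<exists>\<tau>. P t \<tau>" if "t \<in> F" for t
    unfolding P_def using that by blast
  then obtain \<tau> where "\<And>t. t \<in> F \<Longrightarrow> P t (\<tau> t)"
    by metis
  then have
    \<tau>: "\<And>t i. t \<in> F \<Longrightarrow> i \<in> t \<Longrightarrow> ((\<lambda>r. angle_in (ang r) t i) has_derivative \<tau> t i) (at r)"
      "\<And>t h. t \<in> F \<Longrightarrow> \<not> Z h t \<Longrightarrow> (\<Sum>i\<in>t. \<xi> h i * \<tau> t i h) < 0"
      "\<And>t h. t \<in> F \<Longrightarrow> (\<Sum>i\<in>t. \<xi> h i * \<tau> t i h) \<le> 0"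
    unfolding P_def by blast+
  define T where "T = (\<lambda>h. \<chi> i. \<Sum>t\<in>{t\<in>F. i \<in> t}. \<tau> t i h)"
  have "((\<lambda>r. cone_angles (ang r) F) has_derivative T) (at r)"
    unfolding cone_angles_def T_def
    by (subst has_derivative_componentwise_within)
      (auto simp: Basis_vec_def inner_axis intro!: has_derivative_sum \<tau>(1))
  moreover have "Z h t" if "T h = 0" "t \<in> F" for h t
  proof (rule ccontr)
    assume "\<not> Z h t"
    have "0 = (\<Sum>i\<in>UNIV. \<xi> h i * T h $ i)"
      by (simp add: that)
    also have "\<dots> = (\<Sum>i\<in>UNIV. \<Sum>t\<in>{t\<in>F. i \<in> t}. \<xi> h i * \<tau> t i h)"
      by (simp add: T_def sum_distrib_left)
    also have "\<dots> = (\<Sum>t\<in>F. \<Sum>i\<in>{i\<in>UNIV. i \<in> t}. \<xi> h i * \<tau> t i h)"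
      by (rule sum.swap_restrict) auto
    also have "\<dots> = (\<Sum>t\<in>F. \<Sum>i\<in>t. \<xi> h i * \<tau> t i h)" by simp
    also have "\<dots> < (\<Sum>t\<in>F. 0)"
      using \<tau>(2,3) that(2) \<open>\<not> Z h t\<close> by (intro sum_strict_mono_ex1) auto
    finally show False by simp
  qed
  ultimately show ?thesis using that by blast
qed

section \<open>Openness of the set of admissible radii\<close>

lemma open_positive: "open {r :: real^'v::finite. \<forall>i. 0 < r $ i}"
proof -
  have "{r :: real^'v. \<forall>i. 0 < r $ i} = (\<Inter>i. {r. 0 < r $ i})" by auto
  then show ?thesis
    by (auto intro!: open_INT open_Collect_less continuous_intros)
qed

text \<open>Continuity is requested on edges only: elsewhere the weight is unconstrained, and the
  argument of \<open>arcosh\<close> in a hyperbolic length may drop below 1. Since triangles have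
  three distinct vertices, no degenerate labelling such as \<open>i = j\<close> occurs in
  \<open>tri_ineqs\<close>.\<close>

lemma open_tri_ineqs:
  fixes l :: "'a::topological_space \<Rightarrow> 'v::finite \<Rightarrow> 'v \<Rightarrow> real"
  assumes "open P" and card: "\<And>t. t \<in> F \<Longrightarrow> card t = 3"
    and cont: "\<And>i j. {i, j} \<in> tri_edges F \<Longrightarrow> continuous_on P (\<lambda>r. l r i j)"
  shows "open {r\<in>P. tri_ineqs (l r) F}"
proof -
  have "open (P \<inter> (\<lambda>r. l r i k + l r k j - l r i j) -` {0<..})" if "{i, j, k} \<in> F" for i j k
  proof -
    have "i \<noteq> j" "i \<noteq> k" "j \<noteq> k"
      using card[OF that] by (auto simp: card_insert_if split: if_splits)
    then have "{i, j} \<in> tri_edges F" "{i, k} \<in> tri_edges F" "{k, j} \<in> tri_edges F"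
      using that by (auto simp: tri_edges_def intro!: bexI[of _ "{i, j, k}"])
    then show ?thesis
      using \<open>open P\<close> by (intro continuous_open_preimage continuous_intros cont) auto
  qed
  then have "open (P \<inter> (\<Inter>(i, j, k)\<in>{(i, j, k). {i, j, k} \<in> F}. P \<inter> (\<lambda>r. l r i k + l r k j - l r i j) -` {0<..}))"
    using \<open>open P\<close> by (intro open_Int open_INT) auto
  also have "(P \<inter> (\<Inter>(i, j, k)\<in>{(i, j, k). {i, j, k} \<in> F}. P \<inter> (\<lambda>r. l r i k + l r k j - l r i j) -` {0<..})) = {r\<in>P. tri_ineqs (l r) F}"
    by (auto simp: tri_ineqs_def)
  finally show ?thesis .
qed

lemma triangle_edges:
  assumes "{i, j, k} \<in> F" "i \<noteq> j" "i \<noteq> k" "j \<noteq> k"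
  shows "{i, j} \<in> tri_edges F" "{j, k} \<in> tri_edges F" "{k, i} \<in> tri_edges F"
  using assms by (auto simp: tri_edges_def intro!: bexI[of _ "{i, j, k}"])

locale weighted_tri_surface =
  fixes F :: "'v::finite set set" and I :: "'v set \<Rightarrow> real"
  assumes surf: "closed_tri_surface F"
    and weights: "\<forall>e\<in>tri_edges F. 0 \<le> I e"
begin

lemma card_triangle: "t \<in> F \<Longrightarrow> card t = 3"
  using surf by (auto simp: closed_tri_surface_def)

lemma vertex_in_triangle: "\<exists>t\<in>F. v \<in> t"
  using surf by (auto simp: closed_tri_surface_def)

end

section \<open>Hyperbolic triangles\<close>

text \<open>If \<open>m \<le> 0\<close> is the minimum of \<open>B1 x x / B0 x x\<close> on the unit sphere, then \<open>B1 - m B0\<close> is degenerate.\<close>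
lemma positive_definite_pencil:
  fixes B0 B1 :: "'a::euclidean_space \<Rightarrow> 'a \<Rightarrow> real"
  assumes bil: "bilinear B0" "bilinear B1"
    and sym: "\<And>x y. B0 x y = B0 y x" "\<And>x y. B1 x y = B1 y x"
    and pos: "\<And>x. x \<noteq> 0 \<Longrightarrow> 0 < B0 x x"
    and nondeg: "\<And>s x. 0 \<le> s \<Longrightarrow> s \<le> 1 \<Longrightarrow> (\<And>y. (1 - s) * B0 x y + s * B1 x y = 0) \<Longrightarrow> x = 0"
    and "x \<noteq> 0"
  shows "0 < B1 x x"
proof (rule ccontr)
  assume "\<not> 0 < B1 x x"
  have bb: "bounded_bilinear B0" "bounded_bilinear B1"
    using bil by (simp_all add: bilinear_conv_bounded_bilinear)
  define R where "R = (\<lambda>x. B1 x x / B0 x x)"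
  have cont: "continuous_on (sphere 0 1) R"
    unfolding R_def using pos
    by (intro continuous_intros bounded_bilinear.continuous_on[OF bb(1)] bounded_bilinear.continuous_on[OF bb(2)])
      (metis less_irrefl norm_zero mem_sphere_0 zero_neq_one)
  have R_sgn: "R (sgn z) = R z" if "z \<noteq> 0" for z
    using that bil by (simp add: R_def sgn_div_norm bilinear_lmul bilinear_rmul)
  have sgn_sphere: "sgn z \<in> sphere 0 1" if "z \<noteq> 0" for z :: 'a
    using that by (simp add: norm_sgn)
  obtain x0 where x0: "x0 \<in> sphere 0 1" and min: "\<And>z. z \<in> sphere 0 1 \<Longrightarrow> R x0 \<le> R z"
    using continuous_attains_inf[OF _ _ cont] sgn_sphere[OF \<open>x \<noteq> 0\<close>] by auto
  define m where "m = R x0"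
  have "x0 \<noteq> 0" using x0 by auto
  have "m \<le> R x"
    using min[OF sgn_sphere[OF \<open>x \<noteq> 0\<close>]] R_sgn[OF \<open>x \<noteq> 0\<close>] by (simp add: m_def)
  also have "\<dots> \<le> 0"
    using \<open>\<not> 0 < B1 x x\<close> pos[OF \<open>x \<noteq> 0\<close>] by (simp add: R_def divide_le_0_iff)
  finally have "m \<le> 0" .
  define P where "P = (\<lambda>y z. B1 y z - m * B0 y z)"
  have P_nonneg: "0 \<le> P z z" for z
  proof (cases "z = 0")
    case True
    then show ?thesis using bil by (simp add: P_def bilinear_lzero)
  next
    case False
    have "m \<le> R z"
      using min[OF sgn_sphere[OF False]] R_sgn[OF False] by (simp add: m_def)
    then show ?thesis
      using pos[OF False] by (simp add: P_def R_def field_simps)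
  qed
  have P0: "P x0 x0 = 0"
    using pos[OF \<open>x0 \<noteq> 0\<close>] by (simp add: P_def m_def R_def)
  \<comment> \<open>A null vector of a positive semidefinite form lies in its kernel: otherwise a
    small step from \<open>x0\<close> along \<open>y\<close> would make the form negative.\<close>
  have ker: "P x0 y = 0" for y
  proof -
    have expand: "P (x0 + t *\<^sub>R y) (x0 + t *\<^sub>R y) = 2 * t * P x0 y + t\<^sup>2 * P y y" for t
    proof -
      have "P (x0 + t *\<^sub>R y) (x0 + t *\<^sub>R y) = P x0 x0 + 2 * t * P x0 y + t\<^sup>2 * P y y"
        unfolding P_def using bil
        by (simp add: bilinear_ladd bilinear_radd bilinear_lmul bilinear_rmul sym(1)[of y x0] sym(2)[of y x0]
            algebra_simps power2_eq_square)
      then show ?thesis using P0 by simp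
    qed
    define p where "p = P x0 y"
    define q where "q = P y y"
    have q: "0 \<le> q" unfolding q_def by (rule P_nonneg)
    have *: "0 \<le> 2 * t * p + t\<^sup>2 * q" for t
      using P_nonneg[of "x0 + t *\<^sub>R y"] expand[of t] by (simp add: p_def q_def)
    \<comment> \<open>The minimizing step would be \<open>- p / q\<close>; \<open>q + 1\<close>
      serves as well and stays positive when \<open>q = 0\<close>.\<close>
    have "0 \<le> 2 * (- p / (q + 1)) * p + (- p / (q + 1))\<^sup>2 * q" by (rule *)
    also have "\<dots> = - p\<^sup>2 * (q + 2) / (q + 1)\<^sup>2"
      using q by (simp add: divide_simps) (simp add: algebra_simps power2_eq_square power3_eq_cube)
    finally have "p\<^sup>2 * (q + 2) \<le> 0"
      using q by (simp add: divide_le_0_iff zero_le_divide_iff)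
    then have "p = 0"
      using q by (simp add: mult_le_0_iff)
    then show ?thesis by (simp add: p_def)
  qed
  have "x0 = 0"
  proof (rule nondeg)
    \<comment> \<open>With this parameter the pencil is \<open>P\<close> divided by
      \<open>1 - m\<close>; that it lies in the unit interval is where \<open>m \<le> 0\<close>
      enters.\<close>
    show "0 \<le> 1 / (1 - m)" "1 / (1 - m) \<le> 1"
      using \<open>m \<le> 0\<close> by auto
    fix y
    have "(1 - 1 / (1 - m)) * B0 x0 y + 1 / (1 - m) * B1 x0 y = P x0 y / (1 - m)"
      using \<open>m \<le> 0\<close> by (simp add: P_def divide_simps)
    then show "(1 - 1 / (1 - m)) * B0 x0 y + 1 / (1 - m) * B1 x0 y = 0"
      using ker by simp
  qed
  with \<open>x0 \<noteq> 0\<close> show False by simp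
qed

text \<open>Each equation forces opposite signs on two of the numbers. Going once around a cycle of
  odd length yields \<open>sgn a = - sgn a\<close>.\<close>

lemma zero_of_opposite_signs:
  fixes a b c :: real
  assumes "p * a + q * b = 0" "r * b + s * c = 0" "u * c + v * a = 0"
    and "0 < p" "0 < q" "0 < r" "0 < s" "0 < u" "0 < v"
  shows "a = 0 \<and> b = 0 \<and> c = 0"
proof -
  have "sgn a = - sgn b" if "p * a + q * b = 0" "0 < p" "0 < q" for a b p q :: real
  proof -
    have "p * a = q * (- b)" using that by simp
    then have "sgn (p * a) = sgn (q * (- b))" by simp
    then show ?thesis using that by (simp add: sgn_mult)
  qed
  then have "sgn a = - sgn b" "sgn b = - sgn c" "sgn c = - sgn a"
    using assms by metis+
  then have "sgn a = 0" by linarith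
  with \<open>sgn a = - sgn b\<close> \<open>sgn c = - sgn a\<close> show ?thesis
    by (simp add: sgn_0_0)
qed

text \<open>Side \<open>k\<close> is opposite to vertex \<open>k\<close>; \<open>C\<^sub>k = cosh l\<^sub>k\<close>, \<open>c\<^sub>i = cosh r\<^sub>i\<close>, and \<open>x\<^sub>i = du\<^sub>i\<close>. Then \<open>dC\<close> is
  given by \<open>hyp_dcosh\<close>, while \<open>hyp_dangle\<close> and \<open>hyp_weight\<close> are \<open>d\<theta>\<^sub>1\<close> and \<open>\<partial>\<theta>\<^sub>1 / \<partial>u\<^sub>2\<close>, both multiplied by
  \<open>sinh l\<^sub>2 sinh l\<^sub>3 sin \<theta>\<^sub>1\<close>, which is the same for all three vertices.\<close>
definition hyp_weight :: "real \<Rightarrow> real \<Rightarrow> real \<Rightarrow> real \<Rightarrow> real \<Rightarrow> real \<Rightarrow> real" where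
  "hyp_weight C1 C2 C3 c1 c2 c3 = (c1 * (C1 * C3 - C2) + c2 * (C2 * C3 - C1)) / (C3\<^sup>2 - 1) - c3"

definition hyp_dcosh :: "real \<Rightarrow> real \<Rightarrow> real \<Rightarrow> real \<Rightarrow> real \<Rightarrow> real" where
  "hyp_dcosh C c c' x x' = (c * C - c') * x + (c' * C - c) * x'"

definition hyp_dangle :: "real \<Rightarrow> real \<Rightarrow> real \<Rightarrow> real \<Rightarrow> real \<Rightarrow> real \<Rightarrow> real" where
  "hyp_dangle C1 C2 C3 d1 d2 d3 =
     d1 - (C1 * C2 - C3) / (C2\<^sup>2 - 1) * d2 - (C1 * C3 - C2) / (C3\<^sup>2 - 1) * d3"

text \<open>The right side is the coefficient as it arises on differentiating the first angle; the
  definition is its form symmetric in the vertices 1 and 2.\<close>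

lemma hyp_weight_eq:
  assumes "C3\<^sup>2 \<noteq> 1"
  shows "hyp_weight C1 C2 C3 c1 c2 c3 = (c2 * C1 - c3) - (C1 * C3 - C2) / (C3\<^sup>2 - 1) * (c2 * C3 - c1)"
  using assms by (simp add: hyp_weight_def divide_simps) (simp add: algebra_simps power2_eq_square)

text \<open>Because each weight is symmetric in the two ends of its edge, this exhibits the symmetry
  of the Jacobian. The resulting quadratic form is minus the sum over the edges of weight times
  \<open>C * (x\<^sup>2 + y\<^sup>2) - 2 * x * y\<close>, where \<open>x\<close> and
  \<open>y\<close> belong to the ends of the edge.\<close>

lemma hyp_dangle_eq:
  assumes "C2\<^sup>2 \<noteq> 1" "C3\<^sup>2 \<noteq> 1"
  shows "hyp_dangle C1 C2 C3 (hyp_dcosh C1 c2 c3 x2 x3) (hyp_dcosh C2 c3 c1 x3 x1) (hyp_dcosh C3 c1 c2 x1 x2) =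
    hyp_weight C1 C2 C3 c1 c2 c3 * (x2 - C3 * x1) + hyp_weight C3 C1 C2 c3 c1 c2 * (x3 - C2 * x1)"
proof -
  define z2 z3 where "z2 = inverse (C2\<^sup>2 - 1)" and "z3 = inverse (C3\<^sup>2 - 1)"
  have z: "z2 * C2\<^sup>2 = z2 + 1" "z3 * C3\<^sup>2 = z3 + 1"
    using assms by (simp_all add: z2_def z3_def field_simps)
  show ?thesis
    unfolding hyp_dangle_def hyp_weight_def hyp_dcosh_def divide_inverse z2_def[symmetric] z3_def[symmetric]
    using z by algebra
qed

lemma hyp_nondegenerate:
  fixes C1 C2 C3 c1 c2 c3 x1 x2 x3 :: real
  assumes C: "1 < C1" "1 < C2" "1 < C3"
    and A: "0 < 1 + 2 * C1 * C2 * C3 - C1\<^sup>2 - C2\<^sup>2 - C3\<^sup>2"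
    and e: "0 < c2 * C1 - c3" "0 < c3 * C1 - c2" "0 < c3 * C2 - c1" "0 < c1 * C2 - c3"
           "0 < c1 * C3 - c2" "0 < c2 * C3 - c1"
    and d: "d1 = hyp_dcosh C1 c2 c3 x2 x3" "d2 = hyp_dcosh C2 c3 c1 x3 x1" "d3 = hyp_dcosh C3 c1 c2 x1 x2"
    and T: "hyp_dangle C1 C2 C3 d1 d2 d3 = 0" "hyp_dangle C2 C3 C1 d2 d3 d1 = 0" "hyp_dangle C3 C1 C2 d3 d1 d2 = 0"
  shows "x1 = 0 \<and> x2 = 0 \<and> x3 = 0"
proof -
  define A where "A = 1 + 2 * C1 * C2 * C3 - C1\<^sup>2 - C2\<^sup>2 - C3\<^sup>2"
  have S: "0 < C1\<^sup>2 - 1" "0 < C2\<^sup>2 - 1" "0 < C3\<^sup>2 - 1"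
    using C by simp_all
  \<comment> \<open>As \<open>dC = sinh l dl\<close>, these are the variations of the lengths
    divided by \<open>sinh l\<close>.\<close>
  define y1 y2 y3 where "y1 = d1 / (C1\<^sup>2 - 1)" and "y2 = d2 / (C2\<^sup>2 - 1)" and "y3 = d3 / (C3\<^sup>2 - 1)"
  have dy: "d1 = (C1\<^sup>2 - 1) * y1" "d2 = (C2\<^sup>2 - 1) * y2" "d3 = (C3\<^sup>2 - 1) * y3"
    using S by (simp_all add: y1_def y2_def y3_def)
  have G: "(C1\<^sup>2 - 1) * y1 - (C1 * C2 - C3) * y2 - (C1 * C3 - C2) * y3 = 0"
          "(C2\<^sup>2 - 1) * y2 - (C2 * C3 - C1) * y3 - (C2 * C1 - C3) * y1 = 0"
          "(C3\<^sup>2 - 1) * y3 - (C3 * C1 - C2) * y1 - (C3 * C2 - C1) * y2 = 0"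
    using T S unfolding hyp_dangle_def dy by simp_all
  \<comment> \<open>In the hyperboloid model the Gram matrix of the three vertices has diagonal
    entries -1 and off-diagonal entries minus \<open>C1\<close>, \<open>C2\<close>,
    \<open>C3\<close>. The system \<open>G\<close> has minus its adjugate as matrix, and its
    determinant is \<open>- A\<close>; multiplying \<open>G\<close> by the Gram matrix leaves
    \<open>A\<close> times each unknown.\<close>
  have "A * y1 = 0" "A * y2 = 0" "A * y3 = 0"
    unfolding A_def using G by algebra+
  then have "y1 = 0" "y2 = 0" "y3 = 0"
    using A unfolding A_def[symmetric] by auto
  then have "d1 = 0" "d2 = 0" "d3 = 0"
    using dy by simp_all
  then show ?thesis
    using zero_of_opposite_signs[of "c1 * C3 - c2" x1 "c2 * C3 - c1" x2 "c2 * C1 - c3" "c3 * C1 - c2" x3 "c3 * C2 - c1" "c1 * C2 - c3"] e d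
    unfolding hyp_dcosh_def by simp
qed

lemma hyp_edge_form_pos:
  assumes "1 < (C::real)" "x \<noteq> 0 \<or> y \<noteq> 0"
  shows "0 < C * (x\<^sup>2 + y\<^sup>2) - 2 * x * y"
proof -
  have "0 < (C - 1) * (x\<^sup>2 + y\<^sup>2)"
    using assms by (simp add: sum_power2_gt_zero_iff)
  moreover have "0 \<le> (x - y)\<^sup>2" by simp
  ultimately show ?thesis by (simp add: algebra_simps power2_eq_square)
qed

text \<open>The strict triangle inequalities place \<open>cosh l1\<close> strictly between
  \<open>cosh (l2 - l3)\<close> and \<open>cosh (l2 + l3)\<close>. Equivalently, the cosine of the
  angle opposite \<open>l1\<close> lies strictly between -1 and 1.\<close>

lemma hyp_triangle_cosh:
  fixes l1 l2 l3 :: real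
  assumes "l1 < l2 + l3" "l2 < l3 + l1" "l3 < l1 + l2"
  shows "\<bar>cosh l2 * cosh l3 - cosh l1\<bar> < sinh l2 * sinh l3"
proof -
  have "cosh l1 < cosh (l2 + l3)"
    using assms by (subst cosh_real_nonneg_less_iff) auto
  moreover have "cosh \<bar>l2 - l3\<bar> < cosh l1"
    using assms by (subst cosh_real_nonneg_less_iff) auto
  ultimately show ?thesis
    by (simp add: cosh_add cosh_diff abs_less_iff)
qed

lemma hyp_triangle_gram_pos:
  fixes l1 l2 l3 :: real
  assumes tri: "l1 < l2 + l3" "l2 < l3 + l1" "l3 < l1 + l2"
  shows "0 < 1 + 2 * cosh l1 * cosh l2 * cosh l3 - (cosh l1)\<^sup>2 - (cosh l2)\<^sup>2 - (cosh l3)\<^sup>2"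
proof -
  have "(cosh l2 * cosh l3 - cosh l1)\<^sup>2 < (sinh l2 * sinh l3)\<^sup>2"
    using hyp_triangle_cosh[OF tri] abs_le_square_iff[of "sinh l2 * sinh l3" "cosh l2 * cosh l3 - cosh l1"] by linarith
  also have "\<dots> = ((cosh l2)\<^sup>2 - 1) * ((cosh l3)\<^sup>2 - 1)"
    by (simp add: power_mult_distrib sinh_square_eq)
  finally show ?thesis by (simp add: algebra_simps power2_eq_square)
qed

text \<open>For fixed side lengths the form is linear in the \<open>c\<^sub>i\<close>, and the
  conditions under which it is nondegenerate are convex in them; they hold in particular for the
  tangential packing, where all weights are positive.\<close>
lemma hyp_triangle_form_negative:
  fixes l1 l2 l3 c1 c2 c3 x1 x2 x3 :: real
  assumes tri: "l1 < l2 + l3" "l2 < l3 + l1" "l3 < l1 + l2"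
    and C: "C1 = cosh l1" "C2 = cosh l2" "C3 = cosh l3"
    and e: "0 < c2 * C1 - c3" "0 < c3 * C1 - c2" "0 < c3 * C2 - c1" "0 < c1 * C2 - c3"
           "0 < c1 * C3 - c2" "0 < c2 * C3 - c1"
    and d: "d1 = hyp_dcosh C1 c2 c3 x2 x3" "d2 = hyp_dcosh C2 c3 c1 x3 x1" "d3 = hyp_dcosh C3 c1 c2 x1 x2"
    and x: "x1 \<noteq> 0 \<or> x2 \<noteq> 0 \<or> x3 \<noteq> 0"
  shows "x1 * hyp_dangle C1 C2 C3 d1 d2 d3 + x2 * hyp_dangle C2 C3 C1 d2 d3 d1
    + x3 * hyp_dangle C3 C1 C2 d3 d1 d2 < 0"
proof -
  have l: "0 < l1" "0 < l2" "0 < l3"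
    using tri by auto
  have C_gt: "1 < C1" "1 < C2" "1 < C3"
    unfolding C using l cosh_real_nonneg_less_iff[of 0] by auto
  have S: "0 < C1\<^sup>2 - 1" "0 < C2\<^sup>2 - 1" "0 < C3\<^sup>2 - 1"
    using C_gt by simp_all
  have A: "0 < 1 + 2 * C1 * C2 * C3 - C1\<^sup>2 - C2\<^sup>2 - C3\<^sup>2"
    unfolding C by (rule hyp_triangle_gram_pos[OF tri])
  define edge where "edge = (\<lambda>C u v u' v'. C * (u * u' + v * v') - u * v' - v * u' :: real)"
  \<comment> \<open>Minus the polarized form. Keeping two arguments allows its kernel to be tested
    against unit vectors, which by \<open>B_dangle\<close> recovers the individual angle
    variations.\<close>
  define B :: "real \<Rightarrow> real \<Rightarrow> real \<Rightarrow> real \<times> real \<times> real \<Rightarrow> real \<times> real \<times> real \<Rightarrow> real" where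
    "B = (\<lambda>c1 c2 c3 x y.
      hyp_weight C1 C2 C3 c1 c2 c3 * edge C3 (fst x) (fst (snd x)) (fst y) (fst (snd y))
      + hyp_weight C2 C3 C1 c2 c3 c1 * edge C1 (fst (snd x)) (snd (snd x)) (fst (snd y)) (snd (snd y))
      + hyp_weight C3 C1 C2 c3 c1 c2 * edge C2 (snd (snd x)) (fst x) (snd (snd y)) (fst y))"
  have B_dangle: "B c1 c2 c3 (x1, x2, x3) (y1, y2, y3) =
      - (y1 * hyp_dangle C1 C2 C3 (hyp_dcosh C1 c2 c3 x2 x3) (hyp_dcosh C2 c3 c1 x3 x1) (hyp_dcosh C3 c1 c2 x1 x2)
       + y2 * hyp_dangle C2 C3 C1 (hyp_dcosh C2 c3 c1 x3 x1) (hyp_dcosh C3 c1 c2 x1 x2) (hyp_dcosh C1 c2 c3 x2 x3)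
       + y3 * hyp_dangle C3 C1 C2 (hyp_dcosh C3 c1 c2 x1 x2) (hyp_dcosh C1 c2 c3 x2 x3) (hyp_dcosh C2 c3 c1 x3 x1))"
    for c1 c2 c3 x1 x2 x3 y1 y2 y3
    using S by (simp add: hyp_dangle_eq) (simp add: B_def edge_def algebra_simps)
  have bil: "bilinear (B c1 c2 c3)" for c1 c2 c3
    by (auto simp: bilinear_def linear_iff B_def edge_def algebra_simps)
  have sym: "B c1 c2 c3 x y = B c1 c2 c3 y x" for c1 c2 c3 x y
    by (simp add: B_def edge_def algebra_simps)
  have weight_lin: "hyp_weight C1 C2 C3 ((1 - s) * a1 + s * b1) ((1 - s) * a2 + s * b2) ((1 - s) * a3 + s * b3) =
      (1 - s) * hyp_weight C1 C2 C3 a1 a2 a3 + s * hyp_weight C1 C2 C3 b1 b2 b3"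
    for s a1 a2 a3 b1 b2 b3 C1 C2 C3
    by (simp add: hyp_weight_def divide_inverse algebra_simps)
  have B_lin: "B ((1 - s) * a1 + s * b1) ((1 - s) * a2 + s * b2) ((1 - s) * a3 + s * b3) x y =
      (1 - s) * B a1 a2 a3 x y + s * B b1 b2 b3 x y" for s a1 a2 a3 b1 b2 b3 x y
    unfolding B_def weight_lin by (simp add: algebra_simps)
  \<comment> \<open>The radii of the three mutually tangent circles centred at the vertices, that
    is, half the perimeter minus the opposite side; the strict triangle inequalities make them
    positive.\<close>
  define t1 t2 t3 where "t1 = (l2 + l3 - l1) / 2" and "t2 = (l3 + l1 - l2) / 2" and "t3 = (l1 + l2 - l3) / 2"
  have t: "0 < t1" "0 < t2" "0 < t3" and lt: "l1 = t2 + t3" "l2 = t3 + t1" "l3 = t1 + t2"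
    using tri by (auto simp: t1_def t2_def t3_def field_simps)
  have tangential: "cosh u * cosh (u + v) - cosh v = sinh u * sinh (u + v)" for u v :: real
    using cosh_diff[of "u + v" u] by simp
  have e0: "cosh t2 * C1 - cosh t3 = sinh t2 * sinh l1" "cosh t3 * C1 - cosh t2 = sinh t3 * sinh l1"
           "cosh t3 * C2 - cosh t1 = sinh t3 * sinh l2" "cosh t1 * C2 - cosh t3 = sinh t1 * sinh l2"
           "cosh t1 * C3 - cosh t2 = sinh t1 * sinh l3" "cosh t2 * C3 - cosh t1 = sinh t2 * sinh l3"
    unfolding C lt
    using tangential[of t2 t3] tangential[of t3 t2] tangential[of t3 t1] tangential[of t1 t3] tangential[of t1 t2] tangential[of t2 t1]
    by (simp_all add: add.commute)
  \<comment> \<open>At the tangential packing the weight is \<open>sinh t' * sinh l\<close> times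
    one minus the cosine of the angle between the sides \<open>l\<close> and
    \<open>l''\<close>.\<close>
  have weight_pos: "0 < hyp_weight (cosh l) (cosh l') (cosh l'') (cosh t) (cosh t') (cosh t'')"
    if "l' < l + l''" "l < l' + l''" "l'' < l + l'" "0 < t'"
      "cosh t' * cosh l - cosh t'' = sinh t' * sinh l" "cosh t' * cosh l'' - cosh t = sinh t' * sinh l''"
    for l l' l'' t t' t'' :: real
  proof -
    have "0 < l''" using that by linarith
    have K: "cosh l * cosh l'' - cosh l' < sinh l * sinh l''"
      using hyp_triangle_cosh[of l' l l''] that by (simp add: add.commute)
    have sq: "(cosh l'')\<^sup>2 - 1 = (sinh l'')\<^sup>2" by (simp add: sinh_square_eq)
    have "hyp_weight (cosh l) (cosh l') (cosh l'') (cosh t) (cosh t') (cosh t'') =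
       sinh t' * sinh l - (cosh l * cosh l'' - cosh l') / (sinh l'')\<^sup>2 * (sinh t' * sinh l'')"
      using \<open>0 < l''\<close> sq by (subst hyp_weight_eq) (auto simp: that(5,6))
    also have "\<dots> = sinh t' / sinh l'' * (sinh l * sinh l'' - (cosh l * cosh l'' - cosh l'))"
      using \<open>0 < l''\<close> by (simp add: divide_simps power2_eq_square) (simp add: algebra_simps)
    also have "\<dots> > 0"
      using K \<open>0 < l''\<close> \<open>0 < t'\<close> by simp
    finally show ?thesis .
  qed
  have w0: "0 < hyp_weight C1 C2 C3 (cosh t1) (cosh t2) (cosh t3)"
     "0 < hyp_weight C2 C3 C1 (cosh t2) (cosh t3) (cosh t1)"
     "0 < hyp_weight C3 C1 C2 (cosh t3) (cosh t1) (cosh t2)"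
    unfolding C using e0 tri t unfolding C by (intro weight_pos; simp)+
  have "0 < B c1 c2 c3 (x1, x2, x3) (x1, x2, x3)"
  proof (rule positive_definite_pencil[of "B (cosh t1) (cosh t2) (cosh t3)" "B c1 c2 c3"])
    show "0 < B (cosh t1) (cosh t2) (cosh t3) z z" if "z \<noteq> 0" for z
    proof -
      obtain z1 z2 z3 where z: "z = (z1, z2, z3)" by (metis prod.collapse)
      have edge_nonneg: "0 \<le> edge C u v u v" and edge_pos: "u \<noteq> 0 \<or> v \<noteq> 0 \<Longrightarrow> 0 < edge C u v u v" if "1 < C" for C u v
        using hyp_edge_form_pos[OF that, of u v] by (force simp: edge_def power2_eq_square algebra_simps)+
      have ge: "0 \<le> edge C3 z1 z2 z1 z2" "0 \<le> edge C1 z2 z3 z2 z3" "0 \<le> edge C2 z3 z1 z3 z1"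
        using edge_nonneg C_gt by auto
      have "0 < edge C3 z1 z2 z1 z2 \<or> 0 < edge C1 z2 z3 z2 z3"
        using edge_pos C_gt that z by (auto simp: zero_prod_def)
      then have "0 < hyp_weight C1 C2 C3 (cosh t1) (cosh t2) (cosh t3) * edge C3 z1 z2 z1 z2
          + hyp_weight C2 C3 C1 (cosh t2) (cosh t3) (cosh t1) * edge C1 z2 z3 z2 z3"
        using ge w0 by (auto intro: add_pos_nonneg add_nonneg_pos)
      then show ?thesis
        unfolding B_def z using ge w0 by (auto intro: add_pos_nonneg)
    qed
    show "z = 0" if s: "0 \<le> s" "s \<le> 1"
      and ker: "\<And>y. (1 - s) * B (cosh t1) (cosh t2) (cosh t3) z y + s * B c1 c2 c3 z y = 0" for s z
    proof -
      obtain z1 z2 z3 where z: "z = (z1, z2, z3)" by (metis prod.collapse)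
      define a1 a2 a3 where "a1 = (1 - s) * cosh t1 + s * c1" and "a2 = (1 - s) * cosh t2 + s * c2"
        and "a3 = (1 - s) * cosh t3 + s * c3"
      have ker': "B a1 a2 a3 z y = 0" for y
        using ker[of y] by (simp add: a1_def a2_def a3_def B_lin)
      \<comment> \<open>For fixed side lengths the monotonicity conditions are linear in the
        \<open>c\<close>, so they pass from the two end packings to every point of the
        segment.\<close>
      have conv: "0 < ((1 - s) * p + s * q) * D - ((1 - s) * p' + s * q')" if "0 < p * D - p'" "0 < q * D - q'" for p q p' q' D
      proof -
        have "0 < (1 - s) * (p * D - p') + s * (q * D - q')"
          using s that by (cases "s = 0") (auto intro: add_nonneg_pos)
        then show ?thesis by (simp add: algebra_simps)
      qed
      have "z1 = 0 \<and> z2 = 0 \<and> z3 = 0"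
      proof (rule hyp_nondegenerate[OF C_gt A _ _ _ _ _ _ refl refl refl])
        show "0 < a2 * C1 - a3" "0 < a3 * C1 - a2" "0 < a3 * C2 - a1" "0 < a1 * C2 - a3"
             "0 < a1 * C3 - a2" "0 < a2 * C3 - a1"
          unfolding a1_def a2_def a3_def using e e0 t l by (intro conv; simp)+
      \<comment> \<open>Testing the kernel vector on the three unit vectors says that all three
        angle variations vanish.\<close>
      qed (use ker'[of "(1, 0, 0)"] ker'[of "(0, 1, 0)"] ker'[of "(0, 0, 1)"] in \<open>simp_all add: z B_dangle\<close>)
      then show ?thesis by (simp add: z zero_prod_def)
    qed
    show "(x1, x2, x3) \<noteq> 0" using x by (auto simp: zero_prod_def)
  qed (use bil sym in blast)+
  then show ?thesis
    unfolding B_dangle d by linarith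
qed

section \<open>Derivative of the hyperbolic angle formula\<close>

lemma quotient_bounds:
  fixes K M :: real
  assumes "K\<^sup>2 < M\<^sup>2" "0 < M"
  shows "-1 < K / M" "K / M < 1"
proof -
  have "\<bar>K\<bar> < M"
    using assms power2_less_imp_less[of "\<bar>K\<bar>" M] by simp
  then show "-1 < K / M" "K / M < 1"
    using assms(2) by (auto simp: field_simps)
qed

text \<open>Stated for arbitrary functions \<open>C1\<close>, \<open>C2\<close>, \<open>C3\<close>,
  so that cyclic permutation yields all three angles of a triangle with the same
  \<open>A\<close>.\<close>

lemma hyp_angle_has_derivative:
  fixes C1 C2 C3 :: "'a::real_normed_vector \<Rightarrow> real"
  assumes D: "(C1 has_derivative D1) (at r)" "(C2 has_derivative D2) (at r)" "(C3 has_derivative D3) (at r)"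
    and gt: "1 < C2 r" "1 < C3 r"
    and A: "A = 1 + 2 * C1 r * C2 r * C3 r - (C1 r)\<^sup>2 - (C2 r)\<^sup>2 - (C3 r)\<^sup>2" "0 < A"
  shows "((\<lambda>r. arccos ((C3 r * C2 r - C1 r) / (sqrt ((C3 r)\<^sup>2 - 1) * sqrt ((C2 r)\<^sup>2 - 1)))) has_derivative
    (\<lambda>h. hyp_dangle (C1 r) (C2 r) (C3 r) (D1 h) (D2 h) (D3 h) / sqrt A)) (at r)"
proof -
  define u v where "u = sqrt ((C2 r)\<^sup>2 - 1)" and "v = sqrt ((C3 r)\<^sup>2 - 1)"
  define K where "K = C3 r * C2 r - C1 r"
  have S: "0 < (C2 r)\<^sup>2 - 1" "0 < (C3 r)\<^sup>2 - 1"
    using gt by simp_all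
  have uv: "0 < u" "0 < v" and sq: "u\<^sup>2 = (C2 r)\<^sup>2 - 1" "v\<^sup>2 = (C3 r)\<^sup>2 - 1"
    using S by (simp_all add: u_def v_def)
  have A_eq: "A = (v * u)\<^sup>2 - K\<^sup>2"
    unfolding power_mult_distrib sq K_def A by (simp add: algebra_simps power2_eq_square)
  have KK: "K\<^sup>2 < (v * u)\<^sup>2" using A_eq A(2) by simp
  have bound: "-1 < K / (v * u)" "K / (v * u) < 1"
    using quotient_bounds[OF KK] uv by auto
  \<comment> \<open>The sine of the angle. Its denominator cancels the one left by differentiating
    the quotient, so only \<open>sqrt A\<close> remains.\<close>
  have sin: "sqrt (1 - (K / (v * u))\<^sup>2) = sqrt A / (v * u)"
  proof -
    have "1 - (K / (v * u))\<^sup>2 = A / (v * u)\<^sup>2"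
      using uv by (simp add: A_eq field_simps)
    then show ?thesis using uv by (simp add: real_sqrt_divide)
  qed
  have du: "((\<lambda>r. sqrt ((C2 r)\<^sup>2 - 1)) has_derivative (\<lambda>h. C2 r * D2 h / u)) (at r)"
    using S by (auto intro!: derivative_eq_intros D simp: u_def field_simps)
  have dv: "((\<lambda>r. sqrt ((C3 r)\<^sup>2 - 1)) has_derivative (\<lambda>h. C3 r * D3 h / v)) (at r)"
    using S by (auto intro!: derivative_eq_intros D simp: v_def field_simps)
  have dX: "((\<lambda>r. (C3 r * C2 r - C1 r) / (sqrt ((C3 r)\<^sup>2 - 1) * sqrt ((C2 r)\<^sup>2 - 1))) has_derivative
    (\<lambda>h. - hyp_dangle (C1 r) (C2 r) (C3 r) (D1 h) (D2 h) (D3 h) / (v * u))) (at r)"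
  proof (rule has_derivative_eq_rhs[OF has_derivative_divide'[OF has_derivative_diff[OF has_derivative_mult[OF D(3,2)] D(1)] has_derivative_mult[OF dv du]]])
    show "sqrt ((C3 r)\<^sup>2 - 1) * sqrt ((C2 r)\<^sup>2 - 1) \<noteq> 0"
      using uv by (simp add: u_def v_def)
    show "(\<lambda>h. ((C3 r * D2 h + D3 h * C2 r - D1 h) * (sqrt ((C3 r)\<^sup>2 - 1) * sqrt ((C2 r)\<^sup>2 - 1)) -
          (C3 r * C2 r - C1 r) *
          (sqrt ((C3 r)\<^sup>2 - 1) * (C2 r * D2 h / u) + C3 r * D3 h / v * sqrt ((C2 r)\<^sup>2 - 1))) /
         (sqrt ((C3 r)\<^sup>2 - 1) * sqrt ((C2 r)\<^sup>2 - 1) * (sqrt ((C3 r)\<^sup>2 - 1) * sqrt ((C2 r)\<^sup>2 - 1)))) =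
      (\<lambda>h. - hyp_dangle (C1 r) (C2 r) (C3 r) (D1 h) (D2 h) (D3 h) / (v * u))"
    proof
      fix h
      define p q where "p = inverse u" and "q = inverse v"
      have pq: "p * u = 1" "q * v = 1" using uv by (simp_all add: p_def q_def)
      have i: "inverse (u\<^sup>2) = p\<^sup>2" "inverse (v\<^sup>2) = q\<^sup>2" by (simp_all add: p_def q_def power_inverse)
      show "((C3 r * D2 h + D3 h * C2 r - D1 h) * (sqrt ((C3 r)\<^sup>2 - 1) * sqrt ((C2 r)\<^sup>2 - 1)) -
          (C3 r * C2 r - C1 r) *
          (sqrt ((C3 r)\<^sup>2 - 1) * (C2 r * D2 h / u) + C3 r * D3 h / v * sqrt ((C2 r)\<^sup>2 - 1))) /
         (sqrt ((C3 r)\<^sup>2 - 1) * sqrt ((C2 r)\<^sup>2 - 1) * (sqrt ((C3 r)\<^sup>2 - 1) * sqrt ((C2 r)\<^sup>2 - 1))) =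
         - hyp_dangle (C1 r) (C2 r) (C3 r) (D1 h) (D2 h) (D3 h) / (v * u)"
        unfolding u_def[symmetric] v_def[symmetric]
        unfolding hyp_dangle_def sq[symmetric] divide_inverse
          inverse_mult_distrib i p_def[symmetric] q_def[symmetric]
      proof -
        have p2: "p\<^sup>2 * ((C2 r)\<^sup>2 - 1) = 1" and q2: "q\<^sup>2 * ((C3 r)\<^sup>2 - 1) = 1"
          using pq by (simp_all flip: sq power_mult_distrib)
        have "((C3 r * D2 h + D3 h * C2 r - D1 h) * (v * u) -
            (C3 r * C2 r - C1 r) * (v * (C2 r * D2 h * p) + C3 r * D3 h * q * u)) * (q * p * (q * p)) =
          ((C3 r * D2 h + D3 h * C2 r - D1 h) * (q * v) * (p * u) -
            (C3 r * C2 r - C1 r) * ((q * v) * C2 r * D2 h * p\<^sup>2 + C3 r * D3 h * q\<^sup>2 * (p * u))) * (q * p)"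
          by (simp add: algebra_simps power2_eq_square)
        also have "\<dots> = (C3 r * D2 h + D3 h * C2 r - D1 h -
            (C3 r * C2 r - C1 r) * (C2 r * D2 h * p\<^sup>2 + C3 r * D3 h * q\<^sup>2)) * (q * p)"
          by (simp add: pq)
        also have "C3 r * D2 h + D3 h * C2 r - D1 h -
            (C3 r * C2 r - C1 r) * (C2 r * D2 h * p\<^sup>2 + C3 r * D3 h * q\<^sup>2) =
          - (D1 h - (C1 r * C2 r - C3 r) * p\<^sup>2 * D2 h - (C1 r * C3 r - C2 r) * q\<^sup>2 * D3 h)"
          using p2 q2 by algebra
        finally show "((C3 r * D2 h + D3 h * C2 r - D1 h) * (v * u) -
            (C3 r * C2 r - C1 r) * (v * (C2 r * D2 h * p) + C3 r * D3 h * q * u)) * (q * p * (q * p)) =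
          - (D1 h - (C1 r * C2 r - C3 r) * p\<^sup>2 * D2 h - (C1 r * C3 r - C2 r) * q\<^sup>2 * D3 h) * (q * p)" .
      qed
    qed
  qed
  show ?thesis
    by (rule has_derivative_eq_rhs[OF has_derivative_arccos[OF _ _ dX]])
      (use bound uv in \<open>auto simp: u_def[symmetric] v_def[symmetric] K_def[symmetric] sin fun_eq_iff\<close>)
qed

text \<open>The cosines of the angles depend on the lengths only through their \<open>cosh\<close>.
  Using it directly avoids differentiating \<open>arcosh\<close>.\<close>

definition hyp_cosh :: "('v set \<Rightarrow> real) \<Rightarrow> real^'v \<Rightarrow> 'v \<Rightarrow> 'v \<Rightarrow> real" where
  "hyp_cosh I r i j = cosh (r$i) * cosh (r$j) + I {i, j} * sinh (r$i) * sinh (r$j)"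

lemma hyp_cosh_sym: "hyp_cosh I r i j = hyp_cosh I r j i"
  by (simp add: hyp_cosh_def insert_commute mult.commute mult.left_commute)

lemma hyp_len_eq: "hyp_len I r i j = arcosh (hyp_cosh I r i j)"
  by (simp add: hyp_len_def hyp_cosh_def)

lemma hyp_len_sym: "hyp_len I r i j = hyp_len I r j i"
  unfolding hyp_len_eq by (subst hyp_cosh_sym) (rule refl)

lemma hyp_angle_sym: "hyp_angle (hyp_len I r) i k j = hyp_angle (hyp_len I r) i j k"
  by (simp add: hyp_angle_def hyp_len_sym[of I r j k] mult.commute)

lemma hyp_cosh_gt_1:
  fixes r :: "real^'v"
  assumes "0 < r$i" "0 < r$j" "0 \<le> I {i, j}"
  shows "1 < hyp_cosh I r i j"
proof -
  have "1 < cosh (r$i)" "1 < cosh (r$j)"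
    using assms cosh_real_nonneg_less_iff[of 0] by auto
  then have "1 * 1 < cosh (r$i) * cosh (r$j)"
    by (intro mult_strict_mono) auto
  moreover have "0 \<le> I {i, j} * sinh (r$i) * sinh (r$j)"
    using assms by auto
  ultimately show ?thesis by (simp add: hyp_cosh_def)
qed

lemma
  fixes r :: "real^'v"
  assumes "0 < r$i" "0 < r$j" "0 \<le> I {i, j}"
  shows cosh_hyp_len: "cosh (hyp_len I r i j) = hyp_cosh I r i j"
    and sinh_hyp_len: "sinh (hyp_len I r i j) = sqrt ((hyp_cosh I r i j)\<^sup>2 - 1)"
  using hyp_cosh_gt_1[of r i j I, OF assms] by (simp_all add: hyp_len_eq sinh_arcosh_real)

lemma hyp_cosh_has_derivative:
  fixes r :: "real^'v"
  assumes "0 < r$i" "0 < r$j"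
  shows "((\<lambda>r. hyp_cosh I r i j) has_derivative
    (\<lambda>h. hyp_dcosh (hyp_cosh I r i j) (cosh (r$i)) (cosh (r$j)) (h$i / sinh (r$i)) (h$j / sinh (r$j)))) (at r)"
proof -
  have nth: "((\<lambda>r. r$i) has_derivative (\<lambda>h. h$i)) (at r)" for i and r :: "real^'v"
    by (simp add: bounded_linear_imp_has_derivative bounded_linear_vec_nth)
  have cosh_sinh: "((\<lambda>r. cosh (r$i)) has_derivative (\<lambda>h. h$i * sinh (r$i))) (at r)"
      "((\<lambda>r. sinh (r$i)) has_derivative (\<lambda>h. h$i * cosh (r$i))) (at r)" for i
    by (rule DERIV_compose_FDERIV[OF _ nth], rule derivative_eq_intros, auto)+
  have "((\<lambda>r. hyp_cosh I r i j) has_derivative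
    (\<lambda>h. (sinh (r$i) * cosh (r$j) + I {i, j} * cosh (r$i) * sinh (r$j)) * h$i
       + (cosh (r$i) * sinh (r$j) + I {i, j} * sinh (r$i) * cosh (r$j)) * h$j)) (at r)"
    unfolding hyp_cosh_def by (auto intro!: derivative_eq_intros cosh_sinh simp: algebra_simps)
  then show ?thesis
  proof (rule has_derivative_eq_rhs, intro ext)
    fix h :: "real^'v"
    define x y where "x = h$i / sinh (r$i)" and "y = h$j / sinh (r$j)"
    have h: "h$i = sinh (r$i) * x" "h$j = sinh (r$j) * y"
      using assms by (simp_all add: x_def y_def)
    show "(sinh (r$i) * cosh (r$j) + I {i, j} * cosh (r$i) * sinh (r$j)) * h$i
       + (cosh (r$i) * sinh (r$j) + I {i, j} * sinh (r$i) * cosh (r$j)) * h$j =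
      hyp_dcosh (hyp_cosh I r i j) (cosh (r$i)) (cosh (r$j)) (h$i / sinh (r$i)) (h$j / sinh (r$j))"
      unfolding x_def[symmetric] y_def[symmetric]
      unfolding h hyp_dcosh_def hyp_cosh_def
      using hyperbolic_pythagoras[of "r$i"] hyperbolic_pythagoras[of "r$j"] by algebra
  qed
qed

text \<open>The expression is \<open>sinh (r$i)\<close> times the partial derivative of
  \<open>hyp_cosh\<close> in the radius at \<open>i\<close>: a nonnegative inversive distance makes
  the length strictly increasing in each radius.\<close>

lemma hyp_dcosh_coeff_pos:
  fixes r :: "real^'v"
  assumes "0 < r$i" "0 < r$j" "0 \<le> I {i, j}"
  shows "0 < cosh (r$i) * hyp_cosh I r i j - cosh (r$j)"
proof -
  have "cosh (r$i) * hyp_cosh I r i j - cosh (r$j) =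
     (sinh (r$i))\<^sup>2 * cosh (r$j) + I {i, j} * cosh (r$i) * sinh (r$i) * sinh (r$j)"
    unfolding hyp_cosh_def using hyperbolic_pythagoras[of "r$i"] by algebra
  also have "\<dots> > 0"
    using assms by (auto intro!: add_pos_nonneg)
  finally show ?thesis .
qed

section \<open>Hyperbolic packings on the whole surface\<close>

context weighted_tri_surface
begin

lemma open_hyp_admissible: "open (hyp_admissible I F)"
proof -
  have "open {r \<in> {r :: real^'v. \<forall>i. 0 < r$i}. tri_ineqs (hyp_len I r) F}"
  proof (rule open_tri_ineqs[OF open_positive card_triangle])
    fix i j assume "{i, j} \<in> tri_edges F"
    then have ge: "1 \<le> hyp_cosh I r i j" if "\<forall>i. 0 < r$i" for r :: "real^'v"
      using hyp_cosh_gt_1[of r i j I] weights that by auto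
    show "continuous_on {r. \<forall>i. 0 < r$i} (\<lambda>r. hyp_len I r i j)"
      unfolding hyp_len_def
      by (rule continuous_on_compose2[OF continuous_on_arcosh[OF order.refl]], intro continuous_intros)
        (use ge in \<open>auto simp: hyp_cosh_def\<close>)
  qed
  then show ?thesis by (simp add: hyp_admissible_def)
qed

text \<open>Valid on all positive radius vectors, admissible or not, hence on an open set where the
  angle may be replaced by this expression before differentiating.\<close>

lemma hyp_angle_eq:
  assumes "\<forall>i. 0 < r$i" "{i, j, k} \<in> F" "i \<noteq> j" "i \<noteq> k" "j \<noteq> k"
  shows "hyp_angle (hyp_len I r) i j k = arccos ((hyp_cosh I r i j * hyp_cosh I r k i - hyp_cosh I r j k) /
    (sqrt ((hyp_cosh I r i j)\<^sup>2 - 1) * sqrt ((hyp_cosh I r k i)\<^sup>2 - 1)))"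
  unfolding hyp_angle_def hyp_len_sym[of I r i k]
  using assms(1) triangle_edges[OF assms(2-)] weights
  by (simp add: cosh_hyp_len sinh_hyp_len)

lemma hyp_admissible_triangle:
  assumes r: "r \<in> hyp_admissible I F" and t: "{i, j, k} \<in> F"
  shows "hyp_len I r j k < hyp_len I r k i + hyp_len I r i j"
proof -
  have "{i, j, k} = {j, k, i}" by auto
  then have "hyp_len I r j k < hyp_len I r j i + hyp_len I r i k"
    using r t unfolding hyp_admissible_def tri_ineqs_def by blast
  then show ?thesis
    by (simp add: hyp_len_sym[of I r j i] hyp_len_sym[of I r i k])
qed

lemma hyp_gram_pos:
  assumes r: "r \<in> hyp_admissible I F" and t: "{i, j, k} \<in> F" "i \<noteq> j" "i \<noteq> k" "j \<noteq> k"
  shows "0 < 1 + 2 * hyp_cosh I r j k * hyp_cosh I r k i * hyp_cosh I r i j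
    - (hyp_cosh I r j k)\<^sup>2 - (hyp_cosh I r k i)\<^sup>2 - (hyp_cosh I r i j)\<^sup>2"
proof -
  have t': "{j, k, i} \<in> F" "{k, i, j} \<in> F"
    using t(1) by (simp_all add: insert_commute)
  show ?thesis
    using hyp_triangle_gram_pos[OF hyp_admissible_triangle[OF r t(1)] hyp_admissible_triangle[OF r t'(1)]
        hyp_admissible_triangle[OF r t'(2)]] r triangle_edges[OF t] weights
    by (simp add: cosh_hyp_len hyp_admissible_def)
qed

lemma smooth_on_hyp_cone_angle: "smooth_on (hyp_cone_angle I F) (hyp_admissible I F)"
proof -
  let ?S = "hyp_admissible I F"
  have "smooth_on (\<lambda>r. cone_angles (hyp_angle (hyp_len I r)) F) ?S"
  proof (rule smooth_on_cone_angles[OF open_hyp_admissible card_triangle hyp_angle_sym])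
    fix n i j k assume t: "{i, j, k} \<in> F" "i \<noteq> j" "i \<noteq> k" "j \<noteq> k"
    let ?C1 = "\<lambda>r. hyp_cosh I r j k" and ?C2 = "\<lambda>r. hyp_cosh I r k i" and ?C3 = "\<lambda>r. hyp_cosh I r i j"
    have gt: "1 < ?C2 r" "1 < ?C3 r" if "r \<in> ?S" for r
      using that triangle_edges[OF t] weights by (auto intro!: hyp_cosh_gt_1 simp: hyp_admissible_def)
    have kC: "k_diff_on n (\<lambda>r. hyp_cosh I r i j) ?S" for i j
      unfolding hyp_cosh_def
      by (intro k_diff_on_add k_diff_on_mult k_diff_on_const
          k_diff_on_compose[OF open_hyp_admissible k_diff_on_cosh_sinh[THEN conjunct1]]
          k_diff_on_compose[OF open_hyp_admissible k_diff_on_cosh_sinh[THEN conjunct2]]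
          k_diff_on_nth k_diff_on_ident) auto
    have M: "0 < sqrt ((?C3 r)\<^sup>2 - 1) * sqrt ((?C2 r)\<^sup>2 - 1)"
      "(?C3 r * ?C2 r - ?C1 r)\<^sup>2 < (sqrt ((?C3 r)\<^sup>2 - 1) * sqrt ((?C2 r)\<^sup>2 - 1))\<^sup>2" if "r \<in> ?S" for r
    proof -
      have "0 < (?C3 r)\<^sup>2 - 1" "0 < (?C2 r)\<^sup>2 - 1"
        using gt[OF that] by simp_all
      then show "0 < sqrt ((?C3 r)\<^sup>2 - 1) * sqrt ((?C2 r)\<^sup>2 - 1)"
        "(?C3 r * ?C2 r - ?C1 r)\<^sup>2 < (sqrt ((?C3 r)\<^sup>2 - 1) * sqrt ((?C2 r)\<^sup>2 - 1))\<^sup>2"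
        using hyp_gram_pos[OF that t] by (simp_all add: power_mult_distrib) (simp add: algebra_simps power2_eq_square)
    qed
    have "k_diff_on n (\<lambda>r. arccos ((?C3 r * ?C2 r - ?C1 r) / (sqrt ((?C3 r)\<^sup>2 - 1) * sqrt ((?C2 r)\<^sup>2 - 1)))) ?S"
    proof (rule k_diff_on_compose[OF open_hyp_admissible k_diff_on_arccos])
      show "k_diff_on n (\<lambda>r. (?C3 r * ?C2 r - ?C1 r) / (sqrt ((?C3 r)\<^sup>2 - 1) * sqrt ((?C2 r)\<^sup>2 - 1))) ?S"
      proof (intro k_diff_on_divide k_diff_on_diff k_diff_on_mult k_diff_on_sqrt_compose k_diff_on_power k_diff_on_const kC
          open_hyp_admissible)
        fix r assume r: "r \<in> ?S"
        show "0 < (?C3 r)\<^sup>2 - 1" "0 < (?C2 r)\<^sup>2 - 1"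
          using gt[OF r] by simp_all
        show "sqrt ((?C3 r)\<^sup>2 - 1) * sqrt ((?C2 r)\<^sup>2 - 1) \<noteq> 0"
          using M(1)[OF r] by linarith
      qed
    qed (use quotient_bounds[OF M(2,1)] in auto)
    then show "k_diff_on n (\<lambda>r. hyp_angle (hyp_len I r) i j k) ?S"
      by (rule k_diff_on_cong[OF _ open_hyp_admissible]) (auto simp: hyp_angle_eq[OF _ t] hyp_admissible_def)
  qed
  then show ?thesis by (simp add: hyp_cone_angle_def[abs_def])
qed

text \<open>The three derivatives are the \<open>hyp_dangle\<close> terms over the common factor
  \<open>sqrt A\<close>, so the sign of the form survives the division.\<close>

lemma hyp_triangle_variation:
  assumes r: "r \<in> hyp_admissible I F" and t: "{i, j, k} \<in> F" "i \<noteq> j" "i \<noteq> k" "j \<noteq> k"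
  defines "\<xi> \<equiv> \<lambda>h::real^'v. \<lambda>i. h$i / sinh (r$i)"
  shows "\<exists>T1 T2 T3. ((\<lambda>r. hyp_angle (hyp_len I r) i j k) has_derivative T1) (at r) \<and>
        ((\<lambda>r. hyp_angle (hyp_len I r) j k i) has_derivative T2) (at r) \<and>
        ((\<lambda>r. hyp_angle (hyp_len I r) k i j) has_derivative T3) (at r) \<and>
        (\<forall>h. \<not> (\<forall>a\<in>{i, j, k}. h$a = 0) \<longrightarrow> \<xi> h i * T1 h + \<xi> h j * T2 h + \<xi> h k * T3 h < 0) \<and>
        (\<forall>h. \<xi> h i * T1 h + \<xi> h j * T2 h + \<xi> h k * T3 h \<le> 0)"
proof -
  have t': "{j, k, i} \<in> F" "{k, i, j} \<in> F"
    using t(1) by (simp_all add: insert_commute)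
  have pos: "\<forall>i. 0 < r$i" using r by (simp add: hyp_admissible_def)
  have I: "0 \<le> I {i, j}" "0 \<le> I {j, k}" "0 \<le> I {k, i}"
    using triangle_edges[OF t] weights by auto
  let ?C1 = "\<lambda>r. hyp_cosh I r j k" and ?C2 = "\<lambda>r. hyp_cosh I r k i" and ?C3 = "\<lambda>r. hyp_cosh I r i j"
  define A where "A = 1 + 2 * ?C1 r * ?C2 r * ?C3 r - (?C1 r)\<^sup>2 - (?C2 r)\<^sup>2 - (?C3 r)\<^sup>2"
  have A: "0 < A" unfolding A_def by (rule hyp_gram_pos[OF r t])
  have gt: "1 < ?C1 r" "1 < ?C2 r" "1 < ?C3 r"
    using pos I by (auto intro!: hyp_cosh_gt_1)
  define D1 D2 D3 where "D1 = (\<lambda>h. hyp_dcosh (?C1 r) (cosh (r$j)) (cosh (r$k)) (\<xi> h j) (\<xi> h k))"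
    and "D2 = (\<lambda>h. hyp_dcosh (?C2 r) (cosh (r$k)) (cosh (r$i)) (\<xi> h k) (\<xi> h i))"
    and "D3 = (\<lambda>h. hyp_dcosh (?C3 r) (cosh (r$i)) (cosh (r$j)) (\<xi> h i) (\<xi> h j))"
  have D: "(?C1 has_derivative D1) (at r)" "(?C2 has_derivative D2) (at r)" "(?C3 has_derivative D3) (at r)"
    unfolding D1_def D2_def D3_def \<xi>_def using pos by (auto intro!: hyp_cosh_has_derivative)
  define T1 T2 T3 where "T1 = (\<lambda>h. hyp_dangle (?C1 r) (?C2 r) (?C3 r) (D1 h) (D2 h) (D3 h) / sqrt A)"
    and "T2 = (\<lambda>h. hyp_dangle (?C2 r) (?C3 r) (?C1 r) (D2 h) (D3 h) (D1 h) / sqrt A)"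
    and "T3 = (\<lambda>h. hyp_dangle (?C3 r) (?C1 r) (?C2 r) (D3 h) (D1 h) (D2 h) / sqrt A)"
  have der: "((\<lambda>r. hyp_angle (hyp_len I r) i j k) has_derivative T1) (at r)"
       "((\<lambda>r. hyp_angle (hyp_len I r) j k i) has_derivative T2) (at r)"
       "((\<lambda>r. hyp_angle (hyp_len I r) k i j) has_derivative T3) (at r)"
  proof -
    show "((\<lambda>r. hyp_angle (hyp_len I r) i j k) has_derivative T1) (at r)" unfolding T1_def
      by (rule has_derivative_transform_within_open[OF hyp_angle_has_derivative[OF D(1,2,3) gt(2,3) A_def A] open_positive])
        (use pos in \<open>auto simp: hyp_angle_eq[OF _ t]\<close>)
    have A2: "A = 1 + 2 * ?C2 r * ?C3 r * ?C1 r - (?C2 r)\<^sup>2 - (?C3 r)\<^sup>2 - (?C1 r)\<^sup>2"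
      and A3: "A = 1 + 2 * ?C3 r * ?C1 r * ?C2 r - (?C3 r)\<^sup>2 - (?C1 r)\<^sup>2 - (?C2 r)\<^sup>2"
      by (simp_all add: A_def)
    show "((\<lambda>r. hyp_angle (hyp_len I r) j k i) has_derivative T2) (at r)" unfolding T2_def
      by (rule has_derivative_transform_within_open[OF hyp_angle_has_derivative[OF D(2,3,1) gt(3,1) A2 A] open_positive])
        (use pos in \<open>auto simp: hyp_angle_eq[OF _ t'(1) t(4) t(2,3)[symmetric]]\<close>)
    show "((\<lambda>r. hyp_angle (hyp_len I r) k i j) has_derivative T3) (at r)" unfolding T3_def
      by (rule has_derivative_transform_within_open[OF hyp_angle_has_derivative[OF D(3,1,2) gt(1,2) A3 A] open_positive])
        (use pos in \<open>auto simp: hyp_angle_eq[OF _ t'(2) t(3,4)[symmetric] t(2)]\<close>)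
  qed
  have neg: "\<xi> h i * T1 h + \<xi> h j * T2 h + \<xi> h k * T3 h < 0" if "\<xi> h i \<noteq> 0 \<or> \<xi> h j \<noteq> 0 \<or> \<xi> h k \<noteq> 0" for h
  proof -
    have "\<xi> h i * hyp_dangle (?C1 r) (?C2 r) (?C3 r) (D1 h) (D2 h) (D3 h)
      + \<xi> h j * hyp_dangle (?C2 r) (?C3 r) (?C1 r) (D2 h) (D3 h) (D1 h)
      + \<xi> h k * hyp_dangle (?C3 r) (?C1 r) (?C2 r) (D3 h) (D1 h) (D2 h) < 0"
    proof (rule hyp_triangle_form_negative)
      show "hyp_len I r j k < hyp_len I r k i + hyp_len I r i j" "hyp_len I r k i < hyp_len I r i j + hyp_len I r j k"
        "hyp_len I r i j < hyp_len I r j k + hyp_len I r k i"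
        using hyp_admissible_triangle[OF r t(1)] hyp_admissible_triangle[OF r t'(1)] hyp_admissible_triangle[OF r t'(2)] by auto
      show "?C1 r = cosh (hyp_len I r j k)" "?C2 r = cosh (hyp_len I r k i)" "?C3 r = cosh (hyp_len I r i j)"
        using pos I by (simp_all add: cosh_hyp_len)
      show "0 < cosh (r$j) * ?C1 r - cosh (r$k)" "0 < cosh (r$k) * ?C2 r - cosh (r$i)" "0 < cosh (r$i) * ?C3 r - cosh (r$j)"
        using pos I by (intro hyp_dcosh_coeff_pos; simp)+
      show "0 < cosh (r$k) * ?C1 r - cosh (r$j)" "0 < cosh (r$i) * ?C2 r - cosh (r$k)" "0 < cosh (r$j) * ?C3 r - cosh (r$i)"
        unfolding hyp_cosh_sym[of I r j k] hyp_cosh_sym[of I r k i] hyp_cosh_sym[of I r i j]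
        using pos I by (intro hyp_dcosh_coeff_pos; simp add: insert_commute)+
    qed (use that in \<open>simp_all add: D1_def D2_def D3_def\<close>)
    then have "(\<xi> h i * hyp_dangle (?C1 r) (?C2 r) (?C3 r) (D1 h) (D2 h) (D3 h)
      + \<xi> h j * hyp_dangle (?C2 r) (?C3 r) (?C1 r) (D2 h) (D3 h) (D1 h)
      + \<xi> h k * hyp_dangle (?C3 r) (?C1 r) (?C2 r) (D3 h) (D1 h) (D2 h)) / sqrt A < 0"
      using A by (simp add: divide_neg_pos)
    then show ?thesis
      by (simp add: T1_def T2_def T3_def add_divide_distrib)
  qed
  have le: "\<xi> h i * T1 h + \<xi> h j * T2 h + \<xi> h k * T3 h \<le> 0" for h
    using neg[of h] by fastforce
  have "\<xi> h a \<noteq> 0" if "h$a \<noteq> 0" for h a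
    using that pos[rule_format, of a] by (auto simp: \<xi>_def)
  with der neg le show ?thesis
    by (intro exI[of _ T1] exI[of _ T2] exI[of _ T3]) auto
qed

text \<open>A variation in the kernel vanishes on every triangle, and every vertex lies in some
  triangle.\<close>

lemma hyp_cone_angle_derivative_inj:
  assumes "r \<in> hyp_admissible I F"
  shows "\<exists>T. (hyp_cone_angle I F has_derivative T) (at r) \<and> (\<forall>h. T h = 0 \<longrightarrow> h = 0)"
proof -
  obtain T where T: "((\<lambda>r. cone_angles (hyp_angle (hyp_len I r)) F) has_derivative T) (at r)"
    "\<And>h t. T h = 0 \<Longrightarrow> t \<in> F \<Longrightarrow> \<forall>a\<in>t. h$a = 0"
    using cone_angles_derivative_kernel[where Z = "\<lambda>h t. \<forall>a\<in>t. h$a = 0",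
        OF card_triangle hyp_angle_sym hyp_triangle_variation[OF assms]] by blast
  then have "h = 0" if "T h = 0" for h
    using that vertex_in_triangle by (metis vec_eq_iff zero_index)
  with T(1) show ?thesis by (auto simp: hyp_cone_angle_def[abs_def])
qed

lemma hyp_local_diffeo: "local_diffeo (hyp_cone_angle I F) (hyp_admissible I F) UNIV"
  by (rule local_diffeo_inverse_function[OF smooth_on_hyp_cone_angle smooth_on_hyp_cone_angle])
    (use hyp_cone_angle_derivative_inj in auto)

lemma hyp_locally_injective:
  assumes r: "r \<in> hyp_admissible I F"
  shows "\<exists>U. open U \<and> r \<in> U \<and> inj_on (hyp_cone_angle I F) (U \<inter> hyp_admissible I F)"
proof -
  obtain U W g where "open U" "r \<in> U" "\<forall>y\<in>U \<inter> hyp_admissible I F. g (hyp_cone_angle I F y) = y"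
    using hyp_local_diffeo r unfolding local_diffeo_def by blast
  then show ?thesis
    by (intro exI[of _ U]) (auto intro: inj_on_inverseI)
qed

end

section \<open>Euclidean triangles\<close>

text \<open>The Euclidean analogues, with \<open>L\<^sub>k = l\<^sub>k\<^sup>2\<close>, \<open>c\<^sub>i = r\<^sub>i\<^sup>2\<close>, and the common factor \<open>2 l\<^sub>2 l\<^sub>3 sin \<theta>\<^sub>1\<close>, which is
  four times the area.\<close>
definition eucl_weight :: "real \<Rightarrow> real \<Rightarrow> real \<Rightarrow> real \<Rightarrow> real \<Rightarrow> real \<Rightarrow> real" where
  "eucl_weight L1 L2 L3 c1 c2 c3 = (L1 + c2 - c3) - (L1 + L3 - L2) / (2 * L3) * (L3 + c2 - c1)"

definition eucl_dsq :: "real \<Rightarrow> real \<Rightarrow> real \<Rightarrow> real \<Rightarrow> real \<Rightarrow> real" where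
  "eucl_dsq L c c' x x' = (L + c - c') * x + (L + c' - c) * x'"

definition eucl_dangle :: "real \<Rightarrow> real \<Rightarrow> real \<Rightarrow> real \<Rightarrow> real \<Rightarrow> real \<Rightarrow> real" where
  "eucl_dangle L1 L2 L3 d1 d2 d3 =
     d1 - (L1 + L2 - L3) / (2 * L2) * d2 - (L1 + L3 - L2) / (2 * L3) * d3"

text \<open>Only differences of the \<open>x\<close> occur, which is the infinitesimal form of scale
  invariance. The quadratic form is minus the sum over the edges of weight times squared
  difference.\<close>

lemma eucl_dangle_eq:
  assumes "L2 \<noteq> 0" "L3 \<noteq> 0"
  shows "eucl_dangle L1 L2 L3 (eucl_dsq L1 c2 c3 x2 x3) (eucl_dsq L2 c3 c1 x3 x1) (eucl_dsq L3 c1 c2 x1 x2) =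
    eucl_weight L1 L2 L3 c1 c2 c3 * (x2 - x1) + eucl_weight L3 L1 L2 c3 c1 c2 * (x3 - x1)"
proof -
  define z2 z3 where "z2 = inverse L2" and "z3 = inverse L3"
  have z: "z2 * L2 = 1" "z3 * L3 = 1"
    using assms by (simp_all add: z2_def z3_def)
  show ?thesis
    unfolding eucl_dangle_def eucl_weight_def eucl_dsq_def divide_inverse inverse_mult_distrib
      z2_def[symmetric] z3_def[symmetric]
    using z by algebra
qed

lemma eucl_weight_mult:
  assumes "L3 \<noteq> 0"
  shows "2 * L3 * eucl_weight L1 L2 L3 c1 c2 c3 = 2 * L3 * (L1 + c2 - c3) - (L1 + L3 - L2) * (L3 + c2 - c1)"
  using assms unfolding eucl_weight_def by (simp add: right_diff_distrib)

text \<open>\<open>L1\<close>, \<open>L2\<close>, \<open>L3\<close> are the squared distances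
  between the vertices in the plane. The left side is therefore twice the sum of the values that the
  weighted sum of squared differences takes on the two coordinate functions of the vertices. The
  squared radii cancel, and the right side is sixteen times the squared area.\<close>

lemma eucl_weight_sum:
  assumes "L1 \<noteq> 0" "L2 \<noteq> 0" "L3 \<noteq> 0"
    and w: "w3 = eucl_weight L1 L2 L3 c1 c2 c3" "w1 = eucl_weight L2 L3 L1 c2 c3 c1" "w2 = eucl_weight L3 L1 L2 c3 c1 c2"
  shows "2 * (w1 * L1 + w2 * L2 + w3 * L3) = 4 * L2 * L3 - (L2 + L3 - L1)\<^sup>2"
proof -
  have "2 * (w1 * L1 + w2 * L2 + w3 * L3) = 2 * L1 * w1 + 2 * L2 * w2 + 2 * L3 * w3"
    by (simp add: algebra_simps)
  also have "\<dots> = 4 * L2 * L3 - (L2 + L3 - L1)\<^sup>2"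
    unfolding w eucl_weight_mult[OF assms(1)] eucl_weight_mult[OF assms(2)] eucl_weight_mult[OF assms(3)]
    by (simp add: algebra_simps power2_eq_square)
  finally show ?thesis .
qed

text \<open>The sum of products of weights is the determinant of the form modulo constants. The last
  factor on the right is the determinant of the map from \<open>x\<close> to the variations of the
  squared lengths, and it is positive as soon as every length increases with its radii.\<close>

lemma eucl_weight_minor:
  assumes "L1 \<noteq> 0" "L2 \<noteq> 0" "L3 \<noteq> 0"
    and w: "w3 = eucl_weight L1 L2 L3 c1 c2 c3" "w1 = eucl_weight L2 L3 L1 c2 c3 c1" "w2 = eucl_weight L3 L1 L2 c3 c1 c2"
  shows "8 * (L1 * L2 * L3) * (w1 * w2 + w2 * w3 + w3 * w1) = (4 * L2 * L3 - (L2 + L3 - L1)\<^sup>2) *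
    ((L1 + c2 - c3) * (L2 + c3 - c1) * (L3 + c1 - c2) + (L1 + c3 - c2) * (L2 + c1 - c3) * (L3 + c2 - c1))"
proof -
  note v = eucl_weight_mult[OF assms(1)] eucl_weight_mult[OF assms(2)] eucl_weight_mult[OF assms(3)]
  have "8 * (L1 * L2 * L3) * (w1 * w2 + w2 * w3 + w3 * w1) =
    2 * (L3 * (2 * L1 * w1) * (2 * L2 * w2) + L1 * (2 * L2 * w2) * (2 * L3 * w3) + L2 * (2 * L3 * w3) * (2 * L1 * w1))"
    by (simp add: algebra_simps)
  also have "\<dots> = (4 * L2 * L3 - (L2 + L3 - L1)\<^sup>2) *
    ((L1 + c2 - c3) * (L2 + c3 - c1) * (L3 + c1 - c2) + (L1 + c3 - c2) * (L2 + c1 - c3) * (L3 + c2 - c1))"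
    unfolding w v by (simp add: algebra_simps power2_eq_square)
  finally show ?thesis .
qed

text \<open>A positive determinant makes a binary form definite of one sign or the other; that it is
  positive on the coordinates of the triangle, taken together, decides which.\<close>

lemma eucl_triangle_form_positive:
  fixes w1 w2 w3 :: real
  assumes minor: "0 < w1 * w2 + w2 * w3 + w3 * w1"
    and sum: "0 < w1 * L1 + w2 * L2 + w3 * L3"
    and L: "0 < L1" "0 < L2" and tri: "0 < 4 * L1 * L2 - (L1 + L2 - L3)\<^sup>2"
    and x: "x1 \<noteq> x2 \<or> x2 \<noteq> x3"
  shows "0 < w3 * (x1 - x2)\<^sup>2 + w1 * (x2 - x3)\<^sup>2 + w2 * (x3 - x1)\<^sup>2"
proof -
  \<comment> \<open>In the variables \<open>x2 - x3\<close> and \<open>x3 - x1\<close> the form has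
    the matrix entries \<open>a\<close>, \<open>w3\<close>, \<open>b\<close>. \<open>M\<close> is
    twice the inner product of the corresponding edge vectors, and
    \<open>M\<^sup>2 < 4 * L1 * L2\<close> is strict Cauchy-Schwarz.\<close>
  define a b M where "a = w1 + w3" and "b = w2 + w3" and "M = L3 - L1 - L2"
  have ab: "w3\<^sup>2 < a * b"
    using minor by (simp add: a_def b_def algebra_simps power2_eq_square)
  have M: "M\<^sup>2 < 4 * L1 * L2"
    using tri by (simp add: M_def algebra_simps power2_eq_square)
  \<comment> \<open>Combined with completing the square below, this shows that \<open>a\<close> has
    the sign of the positive quantity in \<open>sum\<close>.\<close>
  have "w3\<^sup>2 * M\<^sup>2 < a * b * (4 * L1 * L2)"
    using ab M by (intro mult_strict_mono') auto
  moreover have "4 * L1 * (a * (w1 * L1 + w2 * L2 + w3 * L3)) =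
      (2 * a * L1 + w3 * M)\<^sup>2 + (a * b * (4 * L1 * L2) - w3\<^sup>2 * M\<^sup>2)"
    by (simp add: a_def b_def M_def algebra_simps power2_eq_square)
  ultimately have "0 < 4 * L1 * (a * (w1 * L1 + w2 * L2 + w3 * L3))"
    by (smt (verit) zero_le_power2)
  then have "0 < a"
    using L sum by (simp add: zero_less_mult_iff)
  define y z where "y = x2 - x3" and "z = x3 - x1"
  define Q where "Q = w3 * (x1 - x2)\<^sup>2 + w1 * (x2 - x3)\<^sup>2 + w2 * (x3 - x1)\<^sup>2"
  have "a * Q = (a * y + w3 * z)\<^sup>2 + (a * b - w3\<^sup>2) * z\<^sup>2"
    by (simp add: Q_def a_def b_def y_def z_def algebra_simps power2_eq_square)
  moreover have "0 < (a * y + w3 * z)\<^sup>2 + (a * b - w3\<^sup>2) * z\<^sup>2"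
  proof (cases "z = 0")
    case True
    then have "y \<noteq> 0" using x by (auto simp: y_def z_def)
    with True \<open>0 < a\<close> show ?thesis by simp
  next
    case False
    then show ?thesis using ab by (intro add_nonneg_pos) auto
  qed
  ultimately have "0 < a * Q" by simp
  then show ?thesis
    using \<open>0 < a\<close> by (simp add: Q_def zero_less_mult_iff)
qed

section \<open>Derivative of the Euclidean angle formula and the angle sum\<close>

lemma eucl_angle_has_derivative:
  fixes L1 L2 L3 :: "'a::real_normed_vector \<Rightarrow> real"
  assumes D: "(L1 has_derivative D1) (at r)" "(L2 has_derivative D2) (at r)" "(L3 has_derivative D3) (at r)"
    and gt: "0 < L2 r" "0 < L3 r"
    and A: "A = 4 * L2 r * L3 r - (L2 r + L3 r - L1 r)\<^sup>2" "0 < A"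
  shows "((\<lambda>r. arccos ((L3 r + L2 r - L1 r) / (2 * sqrt (L3 r) * sqrt (L2 r)))) has_derivative
    (\<lambda>h. eucl_dangle (L1 r) (L2 r) (L3 r) (D1 h) (D2 h) (D3 h) / sqrt A)) (at r)"
proof -
  define u v where "u = sqrt (L2 r)" and "v = sqrt (L3 r)"
  define K where "K = L3 r + L2 r - L1 r"
  have uv: "0 < u" "0 < v" and sq: "u\<^sup>2 = L2 r" "v\<^sup>2 = L3 r"
    using gt by (simp_all add: u_def v_def)
  have A_eq: "A = (2 * v * u)\<^sup>2 - K\<^sup>2"
    unfolding power_mult_distrib sq K_def A by (simp add: algebra_simps power2_eq_square)
  have KK: "K\<^sup>2 < (2 * v * u)\<^sup>2" using A_eq A(2) by simp
  have bound: "-1 < K / (2 * v * u)" "K / (2 * v * u) < 1"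
    using quotient_bounds[OF KK] uv by auto
  have sin: "sqrt (1 - (K / (2 * v * u))\<^sup>2) = sqrt A / (2 * v * u)"
  proof -
    have "1 - (K / (2 * v * u))\<^sup>2 = A / (2 * v * u)\<^sup>2"
      using uv by (simp add: A_eq field_simps)
    then show ?thesis using uv by (simp add: real_sqrt_divide)
  qed
  have du: "((\<lambda>r. sqrt (L2 r)) has_derivative (\<lambda>h. D2 h / (2 * u))) (at r)"
    using gt by (auto intro!: derivative_eq_intros D simp: u_def field_simps)
  have dv: "((\<lambda>r. 2 * sqrt (L3 r)) has_derivative (\<lambda>h. D3 h / v)) (at r)"
    using gt by (auto intro!: derivative_eq_intros D simp: v_def field_simps)
  have dX: "((\<lambda>r. (L3 r + L2 r - L1 r) / (2 * sqrt (L3 r) * sqrt (L2 r))) has_derivative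
    (\<lambda>h. - eucl_dangle (L1 r) (L2 r) (L3 r) (D1 h) (D2 h) (D3 h) / (2 * v * u))) (at r)"
  proof (rule has_derivative_eq_rhs[OF has_derivative_divide'[OF has_derivative_diff[OF has_derivative_add[OF D(3,2)] D(1)] has_derivative_mult[OF dv du]]])
    show "2 * sqrt (L3 r) * sqrt (L2 r) \<noteq> 0"
      using uv by (simp add: u_def v_def)
    show "(\<lambda>h. ((D3 h + D2 h - D1 h) * (2 * sqrt (L3 r) * sqrt (L2 r)) -
          (L3 r + L2 r - L1 r) * (2 * sqrt (L3 r) * (D2 h / (2 * u)) + D3 h / v * sqrt (L2 r))) /
         (2 * sqrt (L3 r) * sqrt (L2 r) * (2 * sqrt (L3 r) * sqrt (L2 r)))) =
      (\<lambda>h. - eucl_dangle (L1 r) (L2 r) (L3 r) (D1 h) (D2 h) (D3 h) / (2 * v * u))"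
    proof
      fix h
      define p q where "p = inverse u" and "q = inverse v"
      define z :: real where "z = inverse 2"
      have pq: "p * u = 1" "q * v = 1" "2 * z = 1" using uv by (simp_all add: p_def q_def z_def)
      have i: "inverse (u\<^sup>2) = p\<^sup>2" "inverse (v\<^sup>2) = q\<^sup>2" by (simp_all add: p_def q_def power_inverse)
      show "((D3 h + D2 h - D1 h) * (2 * sqrt (L3 r) * sqrt (L2 r)) -
          (L3 r + L2 r - L1 r) * (2 * sqrt (L3 r) * (D2 h / (2 * u)) + D3 h / v * sqrt (L2 r))) /
         (2 * sqrt (L3 r) * sqrt (L2 r) * (2 * sqrt (L3 r) * sqrt (L2 r))) =
         - eucl_dangle (L1 r) (L2 r) (L3 r) (D1 h) (D2 h) (D3 h) / (2 * v * u)"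
        unfolding u_def[symmetric] v_def[symmetric]
        unfolding eucl_dangle_def sq[symmetric] divide_inverse
          inverse_mult_distrib i p_def[symmetric] q_def[symmetric] z_def[symmetric]
        using pq by algebra
    qed
  qed
  show ?thesis
    by (rule has_derivative_eq_rhs[OF has_derivative_arccos[OF _ _ dX]])
      (use bound uv in \<open>auto simp: u_def[symmetric] v_def[symmetric] K_def[symmetric] sin fun_eq_iff\<close>)
qed

text \<open>Heron's formula: the expression is sixteen times the squared area.\<close>

lemma eucl_heron:
  fixes l1 l2 l3 :: real
  assumes "l1 < l2 + l3" "l2 < l3 + l1" "l3 < l1 + l2"
  shows "0 < 4 * l2\<^sup>2 * l3\<^sup>2 - (l2\<^sup>2 + l3\<^sup>2 - l1\<^sup>2)\<^sup>2"
proof -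
  have "4 * l2\<^sup>2 * l3\<^sup>2 - (l2\<^sup>2 + l3\<^sup>2 - l1\<^sup>2)\<^sup>2 =
     (l1 + l2 + l3) * (l2 + l3 - l1) * (l3 + l1 - l2) * (l1 + l2 - l3)"
    by (simp add: algebra_simps power2_eq_square)
  also have "\<dots> > 0"
    using assms by (intro mult_pos_pos) auto
  finally show ?thesis .
qed

text \<open>The three sines share the numerator \<open>sqrt A\<close>, so the addition formulas
  applied to two angles collapse: the cosine of their sum is minus that of the third angle.\<close>

lemma eucl_angle_sum:
  fixes l1 l2 l3 :: real
  assumes tri: "l1 < l2 + l3" "l2 < l3 + l1" "l3 < l1 + l2"
  shows "arccos ((l3\<^sup>2 + l2\<^sup>2 - l1\<^sup>2) / (2 * l3 * l2)) + arccos ((l1\<^sup>2 + l3\<^sup>2 - l2\<^sup>2) / (2 * l1 * l3))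
    + arccos ((l2\<^sup>2 + l1\<^sup>2 - l3\<^sup>2) / (2 * l2 * l1)) = pi"
proof -
  have l: "0 < l1" "0 < l2" "0 < l3" using tri by auto
  define A where "A = 4 * l2\<^sup>2 * l3\<^sup>2 - (l2\<^sup>2 + l3\<^sup>2 - l1\<^sup>2)\<^sup>2"
  have A: "0 < A" unfolding A_def by (rule eucl_heron[OF tri])
  have arccos_facts: "cos (arccos (K / M)) = K / M" "sin (arccos (K / M)) = sqrt A / M"
      "0 < arccos (K / M)" "arccos (K / M) < pi" "-1 < K / M" "K / M < 1"
    if "0 < M" "M\<^sup>2 - K\<^sup>2 = A" for K M
  proof -
    have "K\<^sup>2 < M\<^sup>2" using that A by linarith
    note b = quotient_bounds[OF this that(1)]
    then show "cos (arccos (K / M)) = K / M" "0 < arccos (K / M)" "arccos (K / M) < pi" "-1 < K / M" "K / M < 1"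
      using arccos_lt_bounded[OF b] by (simp_all add: cos_arccos)
    have "1 - (K / M)\<^sup>2 = A / M\<^sup>2"
      using that(1) unfolding that(2)[symmetric] by (simp add: power_divide diff_divide_distrib)
    then show "sin (arccos (K / M)) = sqrt A / M"
      using sin_arccos[of "K / M"] b that(1) by (simp add: real_sqrt_divide)
  qed
  define K1 K2 K3 where "K1 = l3\<^sup>2 + l2\<^sup>2 - l1\<^sup>2" and "K2 = l1\<^sup>2 + l3\<^sup>2 - l2\<^sup>2" and "K3 = l2\<^sup>2 + l1\<^sup>2 - l3\<^sup>2"
  have M: "0 < 2 * l3 * l2" "0 < 2 * l1 * l3" "0 < 2 * l2 * l1" using l by auto
  have E: "(2 * l3 * l2)\<^sup>2 - K1\<^sup>2 = A" "(2 * l1 * l3)\<^sup>2 - K2\<^sup>2 = A" "(2 * l2 * l1)\<^sup>2 - K3\<^sup>2 = A"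
    by (simp_all add: A_def K1_def K2_def K3_def algebra_simps power2_eq_square)
  note f1 = arccos_facts[OF M(1) E(1)] and f2 = arccos_facts[OF M(2) E(2)] and f3 = arccos_facts(5,6)[OF M(3) E(3)]
  define s where "s = arccos (K1 / (2 * l3 * l2)) + arccos (K2 / (2 * l1 * l3))"
  have "sin s = sqrt A * (K1 + K2) / ((2 * l3 * l2) * (2 * l1 * l3))"
    unfolding s_def sin_add f1(1,2) f2(1,2) using l by (simp add: field_simps)
  also have "K1 + K2 = 2 * l3\<^sup>2" by (simp add: K1_def K2_def)
  finally have "0 < sin s" using A l by simp
  moreover have "0 < s" "s < 2 * pi" using f1(3,4) f2(3,4) by (auto simp: s_def)
  \<comment> \<open>The cosine alone does not determine \<open>s\<close> between 0 and
    \<open>2 * pi\<close>; the positive sine selects the branch on which \<open>arccos\<close>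
    inverts it.\<close>
  ultimately have "s < pi"
    using sin_le_zero[of s] by linarith
  have "cos s = (K1 * K2 - A) / ((2 * l3 * l2) * (2 * l1 * l3))"
    unfolding s_def cos_add f1(1,2) f2(1,2) using l A by (simp add: diff_divide_distrib)
  also have "K1 * K2 - A = - K3 * (2 * l3\<^sup>2)"
    by (simp add: A_def K1_def K2_def K3_def algebra_simps power2_eq_square)
  also have "- K3 * (2 * l3\<^sup>2) / ((2 * l3 * l2) * (2 * l1 * l3)) = - (K3 / (2 * l2 * l1))"
    using l by (simp add: field_simps power2_eq_square)
  finally have "s = arccos (- (K3 / (2 * l2 * l1)))"
    using \<open>0 < s\<close> \<open>s < pi\<close> arccos_cos[of s] by simp
  also have "\<dots> = pi - arccos (K3 / (2 * l2 * l1))"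
    using f3 by (intro arccos_minus) auto
  finally show ?thesis
    by (simp add: s_def K1_def K2_def K3_def)
qed

lemma eucl_triangle_form_negative:
  fixes L1 L2 L3 c1 c2 c3 x1 x2 x3 :: real
  assumes L: "0 < L1" "0 < L2" "0 < L3" and A: "0 < 4 * L2 * L3 - (L2 + L3 - L1)\<^sup>2"
    and e: "0 < L1 + c2 - c3" "0 < L1 + c3 - c2" "0 < L2 + c3 - c1" "0 < L2 + c1 - c3"
           "0 < L3 + c1 - c2" "0 < L3 + c2 - c1"
    and d: "d1 = eucl_dsq L1 c2 c3 x2 x3" "d2 = eucl_dsq L2 c3 c1 x3 x1" "d3 = eucl_dsq L3 c1 c2 x1 x2"
    and x: "x1 \<noteq> x2 \<or> x2 \<noteq> x3"
  shows "x1 * eucl_dangle L1 L2 L3 d1 d2 d3 + x2 * eucl_dangle L2 L3 L1 d2 d3 d1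
    + x3 * eucl_dangle L3 L1 L2 d3 d1 d2 < 0"
proof -
  define w3 w1 w2 where w: "w3 = eucl_weight L1 L2 L3 c1 c2 c3" "w1 = eucl_weight L2 L3 L1 c2 c3 c1" "w2 = eucl_weight L3 L1 L2 c3 c1 c2"
  have nz: "L1 \<noteq> 0" "L2 \<noteq> 0" "L3 \<noteq> 0" using L by auto
  have "0 < 8 * (L1 * L2 * L3) * (w1 * w2 + w2 * w3 + w3 * w1)"
    unfolding eucl_weight_minor[OF nz w] using A e by (intro mult_pos_pos add_pos_pos) auto
  then have minor: "0 < w1 * w2 + w2 * w3 + w3 * w1"
    by (rule zero_less_mult_pos) (use L in simp)
  have sum: "0 < w1 * L1 + w2 * L2 + w3 * L3"
    using eucl_weight_sum[OF nz w] A by simp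
  have "0 < 4 * L1 * L2 - (L1 + L2 - L3)\<^sup>2"
    using A by (simp add: algebra_simps power2_eq_square)
  from eucl_triangle_form_positive[OF minor sum L(1,2) this x]
  have "0 < w3 * (x1 - x2)\<^sup>2 + w1 * (x2 - x3)\<^sup>2 + w2 * (x3 - x1)\<^sup>2" .
  moreover have "x1 * eucl_dangle L1 L2 L3 d1 d2 d3 + x2 * eucl_dangle L2 L3 L1 d2 d3 d1
      + x3 * eucl_dangle L3 L1 L2 d3 d1 d2 = - (w3 * (x1 - x2)\<^sup>2 + w1 * (x2 - x3)\<^sup>2 + w2 * (x3 - x1)\<^sup>2)"
    unfolding d using nz by (simp add: eucl_dangle_eq flip: w) (simp add: algebra_simps power2_eq_square)
  ultimately show ?thesis by linarith
qed

definition eucl_sq :: "('v set \<Rightarrow> real) \<Rightarrow> real^'v \<Rightarrow> 'v \<Rightarrow> 'v \<Rightarrow> real" where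
  "eucl_sq I r i j = (r$i)\<^sup>2 + (r$j)\<^sup>2 + 2 * r$i * r$j * I {i, j}"

lemma eucl_len_eq: "eucl_len I r i j = sqrt (eucl_sq I r i j)"
  by (simp add: eucl_len_def eucl_sq_def)

lemma eucl_sq_sym: "eucl_sq I r i j = eucl_sq I r j i"
  by (simp add: eucl_sq_def insert_commute mult.commute mult.left_commute add.commute)

lemma eucl_len_sym: "eucl_len I r i j = eucl_len I r j i"
  unfolding eucl_len_eq by (subst eucl_sq_sym) (rule refl)

lemma eucl_angle_sym: "eucl_angle (eucl_len I r) i k j = eucl_angle (eucl_len I r) i j k"
  by (simp add: eucl_angle_def eucl_len_sym[of I r j k] mult.commute mult.left_commute add.commute)

lemma eucl_sq_pos:
  fixes r :: "real^'v"
  assumes "0 < r$i" "0 < r$j" "0 \<le> I {i, j}"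
  shows "0 < eucl_sq I r i j"
  unfolding eucl_sq_def using assms by (intro add_pos_nonneg) auto

lemma eucl_sq_has_derivative:
  fixes r :: "real^'v"
  assumes "0 < r$i" "0 < r$j"
  shows "((\<lambda>r. eucl_sq I r i j) has_derivative
    (\<lambda>h. eucl_dsq (eucl_sq I r i j) ((r$i)\<^sup>2) ((r$j)\<^sup>2) (h$i / r$i) (h$j / r$j))) (at r)"
proof -
  have nth: "((\<lambda>r. r$i) has_derivative (\<lambda>h. h$i)) (at r)" for i and r :: "real^'v"
    by (simp add: bounded_linear_imp_has_derivative bounded_linear_vec_nth)
  have "((\<lambda>r. eucl_sq I r i j) has_derivative
    (\<lambda>h. 2 * (r$i + I {i, j} * r$j) * h$i + 2 * (r$j + I {i, j} * r$i) * h$j)) (at r)"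
    unfolding eucl_sq_def by (auto intro!: derivative_eq_intros nth simp: algebra_simps)
  then show ?thesis
  proof (rule has_derivative_eq_rhs, intro ext)
    fix h :: "real^'v"
    define x y where "x = h$i / r$i" and "y = h$j / r$j"
    have h: "h$i = r$i * x" "h$j = r$j * y"
      using assms by (simp_all add: x_def y_def)
    show "2 * (r$i + I {i, j} * r$j) * h$i + 2 * (r$j + I {i, j} * r$i) * h$j =
      eucl_dsq (eucl_sq I r i j) ((r$i)\<^sup>2) ((r$j)\<^sup>2) (h$i / r$i) (h$j / r$j)"
      unfolding x_def[symmetric] y_def[symmetric]
      unfolding h eucl_dsq_def eucl_sq_def
      by (simp add: algebra_simps power2_eq_square)
  qed
qed

text \<open>This is \<open>r$i\<close> times the partial derivative of the squared length in the
  radius at \<open>i\<close>.\<close>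

lemma eucl_dsq_coeff_pos:
  fixes r :: "real^'v"
  assumes "0 < r$i" "0 < r$j" "0 \<le> I {i, j}"
  shows "0 < eucl_sq I r i j + (r$i)\<^sup>2 - (r$j)\<^sup>2"
proof -
  have "eucl_sq I r i j + (r$i)\<^sup>2 - (r$j)\<^sup>2 = 2 * (r$i)\<^sup>2 + 2 * r$i * r$j * I {i, j}"
    by (simp add: eucl_sq_def)
  also have "\<dots> > 0"
    using assms by (intro add_pos_nonneg) auto
  finally show ?thesis .
qed

lemma eucl_len_scaleR:
  assumes "0 \<le> c"
  shows "eucl_len I (c *\<^sub>R r) i j = c * eucl_len I r i j"
proof -
  have "eucl_sq I (c *\<^sub>R r) i j = c\<^sup>2 * eucl_sq I r i j"
    by (simp add: eucl_sq_def algebra_simps power2_eq_square)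
  then show ?thesis
    using assms by (simp add: eucl_len_eq real_sqrt_mult)
qed

lemma eucl_angle_scale:
  assumes "0 < c"
  shows "eucl_angle (\<lambda>i j. c * l i j) = eucl_angle l"
proof (intro ext)
  fix i j k
  have "((c * l i j)\<^sup>2 + (c * l i k)\<^sup>2 - (c * l j k)\<^sup>2) / (2 * (c * l i j) * (c * l i k)) =
      c\<^sup>2 * ((l i j)\<^sup>2 + (l i k)\<^sup>2 - (l j k)\<^sup>2) / (c\<^sup>2 * (2 * l i j * l i k))"
    by (simp add: algebra_simps power2_eq_square)
  also have "\<dots> = ((l i j)\<^sup>2 + (l i k)\<^sup>2 - (l j k)\<^sup>2) / (2 * l i j * l i k)"
    using assms by (intro mult_divide_mult_cancel_left) simp
  finally show "eucl_angle (\<lambda>i j. c * l i j) i j k = eucl_angle l i j k"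
    by (simp add: eucl_angle_def)
qed

section \<open>Euclidean packings on the whole surface\<close>

context weighted_tri_surface
begin

lemma eucl_scale:
  assumes "r \<in> eucl_admissible I F" "0 < c"
  shows "c *\<^sub>R r \<in> eucl_admissible I F" "eucl_cone_angle I F (c *\<^sub>R r) = eucl_cone_angle I F r"
proof -
  have len: "eucl_len I (c *\<^sub>R r) = (\<lambda>i j. c * eucl_len I r i j)"
    using assms(2) by (intro ext eucl_len_scaleR) simp
  show "c *\<^sub>R r \<in> eucl_admissible I F"
    using assms by (simp add: eucl_admissible_def len tri_ineqs_def flip: distrib_left)
  show "eucl_cone_angle I F (c *\<^sub>R r) = eucl_cone_angle I F r"
    by (simp add: eucl_cone_angle_def len eucl_angle_scale[OF assms(2)])
qed

lemma open_eucl_admissible: "open (eucl_admissible I F)"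
proof -
  have "open {r \<in> {r :: real^'v. \<forall>i. 0 < r$i}. tri_ineqs (eucl_len I r) F}"
    by (rule open_tri_ineqs[OF open_positive card_triangle])
      (auto simp: eucl_len_def intro!: continuous_intros)
  then show ?thesis by (simp add: eucl_admissible_def)
qed

lemma eucl_angle_eq:
  assumes "\<forall>i. 0 < r$i" "{i, j, k} \<in> F" "i \<noteq> j" "i \<noteq> k" "j \<noteq> k"
  shows "eucl_angle (eucl_len I r) i j k = arccos ((eucl_sq I r i j + eucl_sq I r k i - eucl_sq I r j k) /
    (2 * sqrt (eucl_sq I r i j) * sqrt (eucl_sq I r k i)))"
  unfolding eucl_angle_def eucl_len_sym[of I r i k]
  unfolding eucl_len_eq
  using assms(1) triangle_edges[OF assms(2-)] weights
  by (simp add: eucl_sq_pos less_imp_le)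

lemma eucl_admissible_triangle:
  assumes r: "r \<in> eucl_admissible I F" and t: "{i, j, k} \<in> F"
  shows "eucl_len I r j k < eucl_len I r k i + eucl_len I r i j"
proof -
  have "{i, j, k} = {j, k, i}" by auto
  then have "eucl_len I r j k < eucl_len I r j i + eucl_len I r i k"
    using r t unfolding eucl_admissible_def tri_ineqs_def by blast
  then show ?thesis
    by (simp add: eucl_len_sym[of I r j i] eucl_len_sym[of I r i k])
qed

lemma eucl_area_pos:
  assumes r: "r \<in> eucl_admissible I F" and t: "{i, j, k} \<in> F" "i \<noteq> j" "i \<noteq> k" "j \<noteq> k"
  shows "0 < 4 * eucl_sq I r k i * eucl_sq I r i j - (eucl_sq I r k i + eucl_sq I r i j - eucl_sq I r j k)\<^sup>2"
proof -
  have t': "{j, k, i} \<in> F" "{k, i, j} \<in> F"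
    using t(1) by (simp_all add: insert_commute)
  show ?thesis
    using eucl_heron[OF eucl_admissible_triangle[OF r t(1)] eucl_admissible_triangle[OF r t'(1)]
        eucl_admissible_triangle[OF r t'(2)]] r triangle_edges[OF t] weights
    by (simp add: eucl_len_eq eucl_admissible_def eucl_sq_pos less_imp_le)
qed

lemma smooth_on_eucl_cone_angle: "smooth_on (eucl_cone_angle I F) (eucl_admissible I F)"
proof -
  let ?S = "eucl_admissible I F"
  have "smooth_on (\<lambda>r. cone_angles (eucl_angle (eucl_len I r)) F) ?S"
  proof (rule smooth_on_cone_angles[OF open_eucl_admissible card_triangle eucl_angle_sym])
    fix n i j k assume t: "{i, j, k} \<in> F" "i \<noteq> j" "i \<noteq> k" "j \<noteq> k"
    let ?L1 = "\<lambda>r. eucl_sq I r j k" and ?L2 = "\<lambda>r. eucl_sq I r k i" and ?L3 = "\<lambda>r. eucl_sq I r i j"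
    have gt: "0 < ?L2 r" "0 < ?L3 r" if "r \<in> ?S" for r
      using that triangle_edges[OF t] weights by (auto intro!: eucl_sq_pos simp: eucl_admissible_def)
    have kL: "k_diff_on n (\<lambda>r. eucl_sq I r i j) ?S" for i j
      unfolding eucl_sq_def
      by (intro k_diff_on_add k_diff_on_mult k_diff_on_const k_diff_on_power k_diff_on_nth k_diff_on_ident)
    have M: "0 < 2 * sqrt (?L3 r) * sqrt (?L2 r)"
      "(?L3 r + ?L2 r - ?L1 r)\<^sup>2 < (2 * sqrt (?L3 r) * sqrt (?L2 r))\<^sup>2" if "r \<in> ?S" for r
    proof -
      show "0 < 2 * sqrt (?L3 r) * sqrt (?L2 r)" using gt[OF that] by simp
      have "(2 * sqrt (?L3 r) * sqrt (?L2 r))\<^sup>2 = 4 * ?L2 r * ?L3 r"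
        using gt[OF that] by (simp add: power_mult_distrib)
      then show "(?L3 r + ?L2 r - ?L1 r)\<^sup>2 < (2 * sqrt (?L3 r) * sqrt (?L2 r))\<^sup>2"
        using eucl_area_pos[OF that t] by (simp add: add.commute)
    qed
    have "k_diff_on n (\<lambda>r. arccos ((?L3 r + ?L2 r - ?L1 r) / (2 * sqrt (?L3 r) * sqrt (?L2 r)))) ?S"
    proof (rule k_diff_on_compose[OF open_eucl_admissible k_diff_on_arccos])
      show "k_diff_on n (\<lambda>r. (?L3 r + ?L2 r - ?L1 r) / (2 * sqrt (?L3 r) * sqrt (?L2 r))) ?S"
      proof (intro k_diff_on_divide k_diff_on_diff k_diff_on_add k_diff_on_mult k_diff_on_sqrt_compose k_diff_on_const kL
          open_eucl_admissible)
        fix r assume r: "r \<in> ?S"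
        show "0 < ?L3 r" "0 < ?L2 r"
          using gt[OF r] by simp_all
        show "2 * sqrt (?L3 r) * sqrt (?L2 r) \<noteq> 0"
          using M(1)[OF r] by linarith
      qed
    qed (use quotient_bounds[OF M(2,1)] in auto)
    then show "k_diff_on n (\<lambda>r. eucl_angle (eucl_len I r) i j k) ?S"
      by (rule k_diff_on_cong[OF _ open_eucl_admissible]) (auto simp: eucl_angle_eq[OF _ t] eucl_admissible_def)
  qed
  then show ?thesis by (simp add: eucl_cone_angle_def[abs_def])
qed

lemma eucl_triangle_variation:
  assumes r: "r \<in> eucl_admissible I F" and t: "{i, j, k} \<in> F" "i \<noteq> j" "i \<noteq> k" "j \<noteq> k"
  defines "\<xi> \<equiv> \<lambda>h::real^'v. \<lambda>i. h$i / r$i"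
  shows "\<exists>T1 T2 T3. ((\<lambda>r. eucl_angle (eucl_len I r) i j k) has_derivative T1) (at r) \<and>
        ((\<lambda>r. eucl_angle (eucl_len I r) j k i) has_derivative T2) (at r) \<and>
        ((\<lambda>r. eucl_angle (eucl_len I r) k i j) has_derivative T3) (at r) \<and>
        (\<forall>h. \<not> (\<forall>a\<in>{i, j, k}. \<forall>b\<in>{i, j, k}. \<xi> h a = \<xi> h b) \<longrightarrow> \<xi> h i * T1 h + \<xi> h j * T2 h + \<xi> h k * T3 h < 0) \<and>
        (\<forall>h. \<xi> h i * T1 h + \<xi> h j * T2 h + \<xi> h k * T3 h \<le> 0)"
proof -
  have t': "{j, k, i} \<in> F" "{k, i, j} \<in> F"
    using t(1) by (simp_all add: insert_commute)
  have pos: "\<forall>i. 0 < r$i" using r by (simp add: eucl_admissible_def)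
  have I: "0 \<le> I {i, j}" "0 \<le> I {j, k}" "0 \<le> I {k, i}"
    using triangle_edges[OF t] weights by auto
  let ?L1 = "\<lambda>r. eucl_sq I r j k" and ?L2 = "\<lambda>r. eucl_sq I r k i" and ?L3 = "\<lambda>r. eucl_sq I r i j"
  define A where "A = 4 * ?L2 r * ?L3 r - (?L2 r + ?L3 r - ?L1 r)\<^sup>2"
  have A: "0 < A" unfolding A_def by (rule eucl_area_pos[OF r t])
  have gt: "0 < ?L1 r" "0 < ?L2 r" "0 < ?L3 r"
    using pos I by (auto intro!: eucl_sq_pos)
  define D1 D2 D3 where "D1 = (\<lambda>h. eucl_dsq (?L1 r) ((r$j)\<^sup>2) ((r$k)\<^sup>2) (\<xi> h j) (\<xi> h k))"
    and "D2 = (\<lambda>h. eucl_dsq (?L2 r) ((r$k)\<^sup>2) ((r$i)\<^sup>2) (\<xi> h k) (\<xi> h i))"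
    and "D3 = (\<lambda>h. eucl_dsq (?L3 r) ((r$i)\<^sup>2) ((r$j)\<^sup>2) (\<xi> h i) (\<xi> h j))"
  have D: "(?L1 has_derivative D1) (at r)" "(?L2 has_derivative D2) (at r)" "(?L3 has_derivative D3) (at r)"
    unfolding D1_def D2_def D3_def \<xi>_def using pos by (auto intro!: eucl_sq_has_derivative)
  define T1 T2 T3 where "T1 = (\<lambda>h. eucl_dangle (?L1 r) (?L2 r) (?L3 r) (D1 h) (D2 h) (D3 h) / sqrt A)"
    and "T2 = (\<lambda>h. eucl_dangle (?L2 r) (?L3 r) (?L1 r) (D2 h) (D3 h) (D1 h) / sqrt A)"
    and "T3 = (\<lambda>h. eucl_dangle (?L3 r) (?L1 r) (?L2 r) (D3 h) (D1 h) (D2 h) / sqrt A)"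
  have der: "((\<lambda>r. eucl_angle (eucl_len I r) i j k) has_derivative T1) (at r)"
       "((\<lambda>r. eucl_angle (eucl_len I r) j k i) has_derivative T2) (at r)"
       "((\<lambda>r. eucl_angle (eucl_len I r) k i j) has_derivative T3) (at r)"
  proof -
    show "((\<lambda>r. eucl_angle (eucl_len I r) i j k) has_derivative T1) (at r)" unfolding T1_def
      by (rule has_derivative_transform_within_open[OF eucl_angle_has_derivative[OF D(1,2,3) gt(2,3) A_def A] open_positive])
        (use pos in \<open>auto simp: eucl_angle_eq[OF _ t]\<close>)
    have A2: "A = 4 * ?L3 r * ?L1 r - (?L3 r + ?L1 r - ?L2 r)\<^sup>2"
      and A3: "A = 4 * ?L1 r * ?L2 r - (?L1 r + ?L2 r - ?L3 r)\<^sup>2"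
      by (simp_all add: A_def algebra_simps power2_eq_square)
    show "((\<lambda>r. eucl_angle (eucl_len I r) j k i) has_derivative T2) (at r)" unfolding T2_def
      by (rule has_derivative_transform_within_open[OF eucl_angle_has_derivative[OF D(2,3,1) gt(3,1) A2 A] open_positive])
        (use pos in \<open>auto simp: eucl_angle_eq[OF _ t'(1) t(4) t(2,3)[symmetric]]\<close>)
    show "((\<lambda>r. eucl_angle (eucl_len I r) k i j) has_derivative T3) (at r)" unfolding T3_def
      by (rule has_derivative_transform_within_open[OF eucl_angle_has_derivative[OF D(3,1,2) gt(1,2) A3 A] open_positive])
        (use pos in \<open>auto simp: eucl_angle_eq[OF _ t'(2) t(3,4)[symmetric] t(2)]\<close>)
  qed
  have sum_eq: "\<xi> h i * T1 h + \<xi> h j * T2 h + \<xi> h k * T3 h =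
      (\<xi> h i * eucl_dangle (?L1 r) (?L2 r) (?L3 r) (D1 h) (D2 h) (D3 h)
      + \<xi> h j * eucl_dangle (?L2 r) (?L3 r) (?L1 r) (D2 h) (D3 h) (D1 h)
      + \<xi> h k * eucl_dangle (?L3 r) (?L1 r) (?L2 r) (D3 h) (D1 h) (D2 h)) / sqrt A" for h
    by (simp add: T1_def T2_def T3_def add_divide_distrib)
  have neg: "\<xi> h i * T1 h + \<xi> h j * T2 h + \<xi> h k * T3 h < 0" if "\<xi> h i \<noteq> \<xi> h j \<or> \<xi> h j \<noteq> \<xi> h k" for h
  proof -
    have "\<xi> h i * eucl_dangle (?L1 r) (?L2 r) (?L3 r) (D1 h) (D2 h) (D3 h)
      + \<xi> h j * eucl_dangle (?L2 r) (?L3 r) (?L1 r) (D2 h) (D3 h) (D1 h)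
      + \<xi> h k * eucl_dangle (?L3 r) (?L1 r) (?L2 r) (D3 h) (D1 h) (D2 h) < 0"
    proof (rule eucl_triangle_form_negative[OF gt A[unfolded A_def]])
      show "0 < ?L1 r + (r$j)\<^sup>2 - (r$k)\<^sup>2" "0 < ?L2 r + (r$k)\<^sup>2 - (r$i)\<^sup>2" "0 < ?L3 r + (r$i)\<^sup>2 - (r$j)\<^sup>2"
        using pos I by (intro eucl_dsq_coeff_pos; simp)+
      show "0 < ?L1 r + (r$k)\<^sup>2 - (r$j)\<^sup>2" "0 < ?L2 r + (r$i)\<^sup>2 - (r$k)\<^sup>2" "0 < ?L3 r + (r$j)\<^sup>2 - (r$i)\<^sup>2"
        unfolding eucl_sq_sym[of I r j k] eucl_sq_sym[of I r k i] eucl_sq_sym[of I r i j]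
        using pos I by (intro eucl_dsq_coeff_pos; simp add: insert_commute)+
    qed (use that in \<open>simp_all add: D1_def D2_def D3_def\<close>)
    then show ?thesis
      unfolding sum_eq using A by (simp add: divide_neg_pos)
  qed
  \<comment> \<open>Infinitesimal scaling changes no angle; semidefiniteness on all \<open>h\<close>
    needs this case besides the strict one.\<close>
  have zero: "\<xi> h i * T1 h + \<xi> h j * T2 h + \<xi> h k * T3 h = 0" if "\<xi> h i = \<xi> h j" "\<xi> h j = \<xi> h k" for h
    unfolding sum_eq D1_def D2_def D3_def using that gt by (simp add: eucl_dangle_eq)
  have le: "\<xi> h i * T1 h + \<xi> h j * T2 h + \<xi> h k * T3 h \<le> 0" for h
    using neg[of h] zero[of h] by fastforce
  from der neg le show ?thesis
    by (intro exI[of _ T1] exI[of _ T2] exI[of _ T3]) auto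
qed

lemma eucl_cone_angle_sum:
  assumes r: "r \<in> eucl_admissible I F"
  shows "(\<Sum>i\<in>UNIV. eucl_cone_angle I F r $ i) = pi * real (card F)"
proof -
  let ?ang = "eucl_angle (eucl_len I r)"
  have "(\<Sum>i\<in>t. angle_in ?ang t i) = pi" if tF: "t \<in> F" for t
  proof -
    obtain i j k where t: "t = {i, j, k}" "i \<noteq> j" "i \<noteq> k" "j \<noteq> k"
      using card_triangle[OF tF] by (auto simp: card_3_iff)
    have t': "t = {j, k, i}" "t = {k, i, j}"
      unfolding t(1) by blast+
    have "angle_in ?ang t i = ?ang i j k"
      unfolding t(1) by (rule angle_in_triple[OF t(2-4) eucl_angle_sym])
    moreover have "angle_in ?ang t j = ?ang j k i"
      unfolding t'(1) by (rule angle_in_triple[OF t(4) t(2,3)[symmetric] eucl_angle_sym])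
    moreover have "angle_in ?ang t k = ?ang k i j"
      unfolding t'(2) by (rule angle_in_triple[OF t(3,4)[symmetric] t(2) eucl_angle_sym])
    moreover have "(\<Sum>a\<in>t. f a) = f i + f j + f k" for f :: "'v \<Rightarrow> real"
      using t by (simp add: add.assoc)
    moreover have "?ang i j k + ?ang j k i + ?ang k i j = pi"
      using eucl_angle_sum[OF eucl_admissible_triangle[OF r tF[unfolded t(1)]] eucl_admissible_triangle[OF r tF[unfolded t'(1)]]
          eucl_admissible_triangle[OF r tF[unfolded t'(2)]]]
      unfolding eucl_angle_def eucl_len_sym[of I r i k] eucl_len_sym[of I r j i] eucl_len_sym[of I r k j] by simp
    ultimately show ?thesis by simp
  qed
  moreover have "(\<Sum>i\<in>UNIV. eucl_cone_angle I F r $ i) = (\<Sum>t\<in>F. \<Sum>i\<in>{i\<in>UNIV. i \<in> t}. angle_in ?ang t i)"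
  proof -
    have "(\<Sum>i\<in>UNIV. eucl_cone_angle I F r $ i) = (\<Sum>i\<in>UNIV. \<Sum>t\<in>{t\<in>F. i \<in> t}. angle_in ?ang t i)"
      by (simp add: eucl_cone_angle_def cone_angles_def)
    also have "\<dots> = (\<Sum>t\<in>F. \<Sum>i\<in>{i\<in>UNIV. i \<in> t}. angle_in ?ang t i)"
      by (rule sum.swap_restrict) auto
    finally show ?thesis .
  qed
  ultimately show ?thesis by simp
qed

text \<open>The added term removes the scaling direction from the kernel of the derivative; by the angle sum
  the preimage of the hyperplane is exactly the normalized set, on which the added term vanishes.\<close>
definition eucl_normalized :: "real^'v \<Rightarrow> real^'v" where
  "eucl_normalized r = eucl_cone_angle I F r + (\<chi> i. (\<Prod>j\<in>UNIV. r$j) - 1)"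

lemma eucl_normalized_sum:
  assumes "r \<in> eucl_admissible I F"
  shows "(\<Sum>i\<in>UNIV. eucl_normalized r $ i) = pi * real (card F) + real CARD('v) * ((\<Prod>j\<in>UNIV. r$j) - 1)"
  using eucl_cone_angle_sum[OF assms] by (simp add: eucl_normalized_def sum.distrib)

lemma smooth_on_eucl_normalized: "smooth_on eucl_normalized (eucl_admissible I F)"
proof -
  have "k_diff_on n eucl_normalized (eucl_admissible I F)" for n
    unfolding eucl_normalized_def[abs_def]
    using smooth_on_eucl_cone_angle
    by (intro k_diff_on_add k_diff_on_vec)
      (auto simp: smooth_on_iff_k_diff_on intro!: k_diff_on_diff k_diff_on_prod k_diff_on_nth k_diff_on_ident)
  then show ?thesis
    by (simp add: smooth_on_iff_k_diff_on open_eucl_admissible)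
qed

text \<open>The derivative of the angles takes values of coordinate sum zero, the derivative of the
  added term is a constant vector, and these subspaces meet only in zero. So both parts vanish on a
  kernel vector: the first makes it a multiple of \<open>r\<close>, the second makes the multiple
  zero. This holds at every admissible \<open>r\<close>, normalized or not.\<close>

lemma eucl_normalized_derivative_inj:
  assumes r: "r \<in> eucl_admissible I F"
  shows "\<exists>T. (eucl_normalized has_derivative T) (at r) \<and> (\<forall>h. T h = 0 \<longrightarrow> h = 0)"
proof -
  have pos: "\<forall>i. 0 < r$i" using r by (simp add: eucl_admissible_def)
  obtain T where T: "((\<lambda>r. cone_angles (eucl_angle (eucl_len I r)) F) has_derivative T) (at r)"
    "\<And>h t. T h = 0 \<Longrightarrow> t \<in> F \<Longrightarrow> \<forall>a\<in>t. \<forall>b\<in>t. h$a / r$a = h$b / r$b"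
    using cone_angles_derivative_kernel[where Z = "\<lambda>h t. \<forall>a\<in>t. \<forall>b\<in>t. h$a / r$a = h$b / r$b",
        OF card_triangle eucl_angle_sym eucl_triangle_variation[OF r]] by blast
  have dT: "(eucl_cone_angle I F has_derivative T) (at r)"
    using T(1) by (simp add: eucl_cone_angle_def[abs_def])
  \<comment> \<open>The coordinate sum of the cone angles is locally constant, so its derivative
    vanishes.\<close>
  have sumT: "(\<Sum>i\<in>UNIV. T h $ i) = 0" for h
  proof -
    have "((\<lambda>r. \<Sum>i\<in>UNIV. eucl_cone_angle I F r $ i) has_derivative (\<lambda>h. \<Sum>i\<in>UNIV. T h $ i)) (at r)"
      by (intro has_derivative_sum bounded_linear.has_derivative[OF bounded_linear_vec_nth dT])
    moreover have "((\<lambda>r. \<Sum>i\<in>UNIV. eucl_cone_angle I F r $ i) has_derivative (\<lambda>h. 0)) (at r)"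
      by (rule has_derivative_transform_within_open[OF has_derivative_const open_eucl_admissible r])
        (simp add: eucl_cone_angle_sum)
    ultimately show ?thesis
      using fun_cong[OF has_derivative_unique] by blast
  qed
  define D where "D = (\<lambda>h::real^'v. \<Sum>i\<in>UNIV. h$i * (\<Prod>j\<in>UNIV - {i}. r$j))"
  have nth: "((\<lambda>r. r$i) has_derivative (\<lambda>h. h$i)) (at r)" for i and r :: "real^'v"
    by (simp add: bounded_linear_imp_has_derivative bounded_linear_vec_nth)
  have dD: "((\<lambda>r. (\<Prod>j\<in>UNIV. r$j) - 1) has_derivative D) (at r)"
    unfolding D_def by (auto intro!: derivative_eq_intros nth)
  have "(eucl_normalized has_derivative (\<lambda>h. T h + (\<chi> i. D h))) (at r)"
    unfolding eucl_normalized_def[abs_def]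
    by (intro has_derivative_add dT, subst has_derivative_componentwise_within)
      (use dD in \<open>auto simp: Basis_vec_def inner_axis\<close>)
  moreover have "h = 0" if "T h + (\<chi> i. D h) = 0" for h
  proof -
    have comp: "T h $ i = - D h" for i
      using arg_cong[OF that, of "\<lambda>v. v $ i"] by (simp add: eq_neg_iff_add_eq_0)
    then have "D h = 0"
      using sumT[of h] by simp
    then have "T h = 0"
      using comp by (simp add: vec_eq_iff)
    have edge: "h$a / r$a = h$b / r$b" if "{a, b} \<in> tri_edges F" for a b
      using T(2)[OF \<open>T h = 0\<close>] that by (auto simp: tri_edges_def)
    \<comment> \<open>The logarithmic variation is constant on each triangle, and the edge graph is
      connected.\<close>
    have const: "h$a / r$a = h$b / r$b" for a b
    proof -
      have "(a, b) \<in> {(a, b). {a, b} \<in> tri_edges F}\<^sup>*"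
        using surf by (auto simp: closed_tri_surface_def)
      then show ?thesis
        by induction (auto dest: edge)
    qed
    \<comment> \<open>\<open>undefined\<close> serves as an arbitrary reference vertex.\<close>
    define c where "c = h$undefined / r$undefined"
    have h: "h$i = c * r$i" for i
      using const[of i undefined] pos[rule_format, of i] by (simp add: c_def field_simps)
    have "D h = (\<Sum>i::'v\<in>UNIV. c * (\<Prod>j\<in>UNIV. r$j))"
      unfolding D_def h
    proof (intro sum.cong refl)
      fix i
      have "(\<Prod>j\<in>UNIV. r$j) = r$i * (\<Prod>j\<in>UNIV - {i}. r$j)"
        by (rule prod.remove) auto
      then show "c * r$i * (\<Prod>j\<in>UNIV - {i}. r$j) = c * (\<Prod>j\<in>UNIV. r$j)"
        by simp
    qed
    then have "c * (\<Prod>j\<in>UNIV. r$j) = 0"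
      using \<open>D h = 0\<close> by simp
    moreover have "0 < (\<Prod>j\<in>UNIV. r$j)"
      using pos by (intro prod_pos) auto
    ultimately have "c = 0" by (metis mult_eq_0_iff less_irrefl)
    then show "h = 0" using h by (simp add: vec_eq_iff)
  qed
  ultimately show ?thesis
    by (intro exI[of _ "\<lambda>h. T h + (\<chi> i. D h)"] conjI allI impI)
qed

lemma eucl_local_diffeo:
  "local_diffeo (eucl_cone_angle I F) {r \<in> eucl_admissible I F. (\<Prod>i\<in>UNIV. r$i) = 1}
     {x. (\<Sum>i\<in>UNIV. x$i) = pi * real (card F)}"
proof (rule local_diffeo_inverse_function[OF smooth_on_eucl_cone_angle smooth_on_eucl_normalized])
  fix r :: "real^'v"
  show "r \<in> {r \<in> eucl_admissible I F. (\<Prod>i\<in>UNIV. r$i) = 1} \<longleftrightarrow>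
    r \<in> eucl_admissible I F \<and> eucl_normalized r \<in> {x. (\<Sum>i\<in>UNIV. x$i) = pi * real (card F)}"
    using eucl_normalized_sum[of r] by auto
next
  fix r :: "real^'v"
  assume r: "r \<in> {r \<in> eucl_admissible I F. (\<Prod>i\<in>UNIV. r$i) = 1}"
  then show "eucl_normalized r = eucl_cone_angle I F r"
    by (simp add: eucl_normalized_def vec_eq_iff)
  show "\<exists>T. (eucl_normalized has_derivative T) (at r) \<and> (\<forall>h. T h = 0 \<longrightarrow> h = 0)"
    using r by (intro eucl_normalized_derivative_inj) simp
qed

text \<open>A nearby \<open>x\<close> is rescaled until its product of radii equals that of
  \<open>r\<close>. If the cone angles agree, then so do the values of
  \<open>eucl_normalized\<close>, which is injective near \<open>r\<close>, and the rescaled vector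
  is \<open>r\<close> itself. Rescaling to the product of \<open>r\<close> avoids normalizing
  \<open>r\<close> first.\<close>

lemma eucl_locally_rigid:
  assumes r: "r \<in> eucl_admissible I F"
  shows "\<exists>U. open U \<and> r \<in> U \<and> (\<forall>r'\<in>U \<inter> eucl_admissible I F.
    eucl_cone_angle I F r' = eucl_cone_angle I F r \<longrightarrow> (\<exists>c>0. r' = c *\<^sub>R r))"
proof -
  let ?P = "{r :: real^'v. \<forall>i. 0 < r$i}"
  have rP: "r \<in> ?P" using r by (simp add: eucl_admissible_def)
  have prod_pos: "0 < (\<Prod>i\<in>UNIV. x$i)" if "x \<in> ?P" for x :: "real^'v"
    using that by (intro prod_pos) auto
  obtain T where T: "(eucl_normalized has_derivative T) (at r)" "\<And>h. T h = 0 \<Longrightarrow> h = 0"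
    using eucl_normalized_derivative_inj[OF r] by blast
  obtain U V g where U: "open U" "U \<subseteq> eucl_admissible I F" "r \<in> U" and "open V" "eucl_normalized ` U = V" "g ` V = U"
    and g: "\<forall>y\<in>U. g (eucl_normalized y) = y" and "\<forall>z\<in>V. eucl_normalized (g z) = z" "smooth_on g V"
    using smooth_inverse_function[OF smooth_on_eucl_normalized r T] .
  define n where "n = CARD('v)"
  have n: "0 < n" by (simp add: n_def)
  \<comment> \<open>Scaling by \<open>s x\<close> multiplies the product of all radii by its
    \<open>n\<close>-th power, whence the root.\<close>
  define s where "s = (\<lambda>x::real^'v. root n ((\<Prod>i\<in>UNIV. r$i) / (\<Prod>i\<in>UNIV. x$i)))"
  have s_pos: "0 < s x" if "x \<in> ?P" for x
    using prod_pos[OF that] prod_pos[OF rP] n by (simp add: s_def)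
  have "continuous_on ?P (\<lambda>x. s x *\<^sub>R x)"
    unfolding s_def by (intro continuous_intros ballI) (metis prod_pos less_irrefl)
  then have "open (?P \<inter> (\<lambda>x. s x *\<^sub>R x) -` U)"
    by (rule continuous_open_preimage[OF _ open_positive U(1)])
  moreover have "s r = 1"
    unfolding s_def divide_self[OF less_imp_neq[OF prod_pos[OF rP], symmetric]] using n by simp
  then have "r \<in> ?P \<inter> (\<lambda>x. s x *\<^sub>R x) -` U"
    using U(3) rP by simp
  moreover have "\<exists>c>0. x = c *\<^sub>R r"
    if x: "x \<in> ?P" "s x *\<^sub>R x \<in> U" "x \<in> eucl_admissible I F" "eucl_cone_angle I F x = eucl_cone_angle I F r" for x
  proof -
    have "(\<Prod>i\<in>UNIV. (s x *\<^sub>R x)$i) = s x ^ n * (\<Prod>i\<in>UNIV. x$i)"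
      by (simp add: prod.distrib n_def)
    also have "s x ^ n = (\<Prod>i\<in>UNIV. r$i) / (\<Prod>i\<in>UNIV. x$i)"
      using prod_pos[OF x(1)] prod_pos[OF rP] n by (simp add: s_def less_imp_le)
    also have "\<dots> * (\<Prod>i\<in>UNIV. x$i) = (\<Prod>i\<in>UNIV. r$i)"
      by (rule nonzero_eq_divide_eq[THEN iffD1, OF _ refl]) (use prod_pos[OF x(1)] in linarith)
    finally have "eucl_normalized (s x *\<^sub>R x) = eucl_normalized r"
      by (simp only: eucl_normalized_def eucl_scale(2)[OF x(3) s_pos[OF x(1)]] x(4))
    then have "g (eucl_normalized (s x *\<^sub>R x)) = g (eucl_normalized r)"
      by (rule arg_cong)
    then have eq: "s x *\<^sub>R x = r"
      unfolding g[rule_format, OF x(2)] g[rule_format, OF U(3)] .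
    have "(1 / s x) *\<^sub>R (s x *\<^sub>R x) = x"
      using s_pos[OF x(1)] by simp
    then have "x = (1 / s x) *\<^sub>R r"
      unfolding eq by (rule sym)
    moreover have "0 < 1 / s x"
      using s_pos[OF x(1)] by simp
    ultimately show ?thesis by blast
  qed
  ultimately show ?thesis
    by (intro exI[of _ "?P \<inter> (\<lambda>x. s x *\<^sub>R x) -` U"]) blast
qed

end

theorem theorem1p2:
  fixes F :: "'v::finite set set" and I :: "'v set \<Rightarrow> real"
  assumes surf: "closed_tri_surface F"
    and weights: "\<forall>e\<in>tri_edges F. 0 \<le> I e"
  shows
    "(\<forall>r\<in>eucl_admissible I F. \<forall>c::real. c > 0 \<longrightarrow>
        c *\<^sub>R r \<in> eucl_admissible I F \<and> eucl_cone_angle I F (c *\<^sub>R r) = eucl_cone_angle I F r)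
     \<and> local_diffeo (eucl_cone_angle I F)
         {r\<in>eucl_admissible I F. (\<Prod>i\<in>UNIV. r$i) = 1}
         {x. (\<Sum>i\<in>UNIV. x$i) = pi * real (card F)}
     \<and> (\<forall>r\<in>eucl_admissible I F. \<exists>U. open U \<and> r \<in> U \<and>
          (\<forall>r'\<in>U \<inter> eucl_admissible I F. eucl_cone_angle I F r' = eucl_cone_angle I F r \<longrightarrow>
             (\<exists>c::real. c > 0 \<and> r' = c *\<^sub>R r)))
     \<and> local_diffeo (hyp_cone_angle I F) (hyp_admissible I F) UNIV
     \<and> (\<forall>r\<in>hyp_admissible I F. \<exists>U. open U \<and> r \<in> U \<and>
          inj_on (hyp_cone_angle I F) (U \<inter> hyp_admissible I F))"
proof -
  interpret weighted_tri_surface F I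
    using surf weights by unfold_locales
  show ?thesis
    by (intro conjI ballI allI impI eucl_scale eucl_local_diffeo eucl_locally_rigid hyp_local_diffeo hyp_locally_injective)
qed

end
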